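(* Let $K$ be a link in $S^3$ with an adequate diagram $D(K)$, such that every twist region of $D(K)$ contains at least $3$ crossings. Let $\beta$ and $\beta'$ be the second and next-to-last coefficients of the Jones polynomial of $K$. Then $$\frac{1}{3}\,\mathrm{tw}(D) + 1 \;\leq\; |\beta| + |\beta'| \;\leq\; 2\,\mathrm{tw}(D).$$
   Context: A link diagram is viewed as a $4$-valent graph in the plane, with over-under crossing information at each vertex. A bigon region is a region of the graph bounded by only two edges. A twist region of a diagram is a maximal collection of bigon regions arranged end to end; a single crossing adjacent to no bigons is also a twist region. $\mathrm{tw}(D)$ is the number of twist regions of $D$. Standing assumption: all link diagrams are connected and are alternating within each twist region. At each crossing of $D$ there are two ways to resolve it to obtain a diagram with one fewer crossing, the $A$-resolution and the $B$-resolution (the standard Kauffman-bracket smoothings). Let $s_A(D)$ (resp. $s_B(D)$) be the crossing-free diagram obtained by applying the $A$-resolution (resp. $B$-resolution) to all crossings. The graph $\mathbb{G}_A$ has one vertex for each component of $s_A(D)$, and one edge for each crossing $x$ of $D$, joining the vertices corresponding to the components containing the two arcs of the $A$-resolution of $x$. The graph $\mathbb{G}_B$ is defined similarly using $s_B(D)$. $D$ is $A$-adequate (resp. $B$-adequate) if $\mathbb{G}_A$ (resp. $\mathbb{G}_B$) has no loops (edges with both endpoints at the same vertex), and adequate if it is both $A$-adequate and $B$-adequate. The Jones polynomial of $K$ is written $J_K(t)= \alpha t^n+ \beta t^{n-1}+ \cdots + \beta' t^{s+1}+ \alpha' t^s$, where $n$ (resp. $s$) is the highest (resp. lowest) power of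 $t$ (exponents may be half-integers); $\beta$ is the coefficient of $t^{n-1}$ and $\beta'$ the coefficient of $t^{s+1}$.
   Formalization: The lower bound is stated only for tw(D) ≥ 2, since it fails for tw(D) = 1 (the standard trefoil diagram has |β|+|β'| = 1 < 4/3, as do all standard (2,n) torus link diagrams, the only such cases); diagrams are assumed to have at least one crossing. *)

theory Defs
  imports
    "HOL-Computational_Algebra.Formal_Laurent_Series"
    "HOL-Library.Numeral_Type"
    "HOL-Library.FuncSet"
    Complex_Main
begin

section \<open>Oriented link diagrams\<close>

text \<open>
  A connected oriented link diagram with at least one crossing is given as a 4-valent plane graph
  in the form of a combinatorial map. The four half-edges (darts) at a crossing \<open>x\<close> are
  \<open>(x, 0), (x, 1), (x, 2), (x, 3)\<close> in counterclockwise order, with indices modulo 4. The understrand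
  consists of \<open>(x, 0)\<close> and \<open>(x, 2)\<close>, the overstrand of \<open>(x, 1)\<close> and \<open>(x, 3)\<close>. The map \<open>join\<close> sends a
  dart to the other half of its edge, and \<open>outward d\<close> says that the orientation of the link
  leaves the crossing along \<open>d\<close>.
\<close>

type_synonym 'x dart = "'x \<times> 4"

record 'x link_diagram =
  crossings :: "'x set"
  join :: "'x dart \<Rightarrow> 'x dart"
  outward :: "'x dart \<Rightarrow> bool"

definition darts :: "'x link_diagram \<Rightarrow> 'x dart set" where
  "darts D = crossings D \<times> UNIV"

definition over :: "'x dart \<Rightarrow> bool" where
  "over d \<longleftrightarrow> snd d \<in> {1, 3}"

definition components :: "'a set \<Rightarrow> ('a \<times> 'a) set \<Rightarrow> 'a set set" where
  "components S r = S // ((r \<union> r\<inverse>) \<inter> S \<times> S)\<^sup>*"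

definition adjacent :: "'x link_diagram \<Rightarrow> ('x \<times> 'x) set" where
  "adjacent D = {(x, y). \<exists>i j. (x, i) \<in> darts D \<and> join D (x, i) = (y, j)}"

text \<open>
  Leaving a crossing along \<open>d\<close> and turning left at the next crossing \<open>y\<close> leads to the dart
  \<open>next_side D d\<close>. Hence the regions of the complement of the graph in the sphere correspond to the
  orbits of \<open>next_side D\<close>: each region is the set of those darts that have it on their left.
  In particular, \<open>(x, i)\<close> belongs to the region that has a corner at \<open>x\<close> between \<open>(x, i)\<close> and
  \<open>(x, i + 1)\<close>. The cardinality of a region is the number of its edges, since a 4-valent graph has
  no bridge and so no edge has the same region on both sides.
\<close>

definition next_side :: "'x link_diagram \<Rightarrow> 'x dart \<Rightarrow> 'x dart" where
  "next_side D d = (case join D d of (y, j) \<Rightarrow> (y, j - 1))"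

definition regions :: "'x link_diagram \<Rightarrow> 'x dart set set" where
  "regions D = components (darts D) {(d, next_side D d) | d. d \<in> darts D}"

text \<open>
  A 4-valent graph with \<open>v\<close> vertices has \<open>2 * v\<close> edges, so the last equation is Euler's formula
  and says that the connected map lies on a sphere.
\<close>

definition link_diagram :: "'x link_diagram \<Rightarrow> bool" where
  "link_diagram D \<longleftrightarrow>
     finite (crossings D) \<and> crossings D \<noteq> {} \<and>
     (\<forall>d\<in>darts D. join D d \<in> darts D \<and> join D d \<noteq> d \<and> join D (join D d) = d) \<and>
     (\<forall>d\<in>darts D. outward D (join D d) \<longleftrightarrow> \<not> outward D d) \<and>
     (\<forall>x\<in>crossings D. \<forall>i. outward D (x, i + 2) \<longleftrightarrow> \<not> outward D (x, i)) \<and>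
     (\<forall>x\<in>crossings D. \<forall>y\<in>crossings D. (x, y) \<in> (adjacent D)\<^sup>*) \<and>
     card (regions D) = card (crossings D) + 2"


section \<open>Twist regions\<close>

definition bigons :: "'x link_diagram \<Rightarrow> 'x dart set set" where
  "bigons D = {R \<in> regions D. card R = 2}"

text \<open>Two bigons are arranged end to end if they occupy opposite corners of some crossing.\<close>

definition end_to_end :: "'x link_diagram \<Rightarrow> ('x dart set \<times> 'x dart set) set" where
  "end_to_end D = {(R, R'). \<exists>x i. (x, i) \<in> R \<and> (x, i + 2) \<in> R'}"

text \<open>A twist region is represented by the set of its crossings.\<close>

definition twist_regions :: "'x link_diagram \<Rightarrow> 'x set set" where
  "twist_regions D =
     {fst ` \<Union>\<C> | \<C>. \<C> \<in> components (bigons D) (end_to_end D)} \<union>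
     {{x} | x. x \<in> crossings D \<and> (\<forall>R\<in>bigons D. x \<notin> fst ` R)}"

definition tw :: "'x link_diagram \<Rightarrow> nat" where
  "tw D = card (twist_regions D)"

text \<open>
  The strands run through a twist region along the edges of its bigons, so it is alternating
  iff each of these edges is over at one end and under at the other.
\<close>

definition alternating_in_twist_regions :: "'x link_diagram \<Rightarrow> bool" where
  "alternating_in_twist_regions D \<longleftrightarrow>
     (\<forall>R\<in>bigons D. \<forall>d\<in>R. over (join D d) \<longleftrightarrow> \<not> over d)"


section \<open>Resolutions and adequacy\<close>

datatype resolution = ResA | ResB

text \<open>
  Turning the overstrand counterclockwise sweeps out the corner between the darts 1 and 2 and the
  corner between 3 and 0. The \<open>A\<close>-resolution merges these two corners, hence its arcs connect 0 with
  1 and 2 with 3. The arcs of the \<open>B\<close>-resolution connect 0 with 3 and 1 with 2.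
\<close>

definition reconnect :: "resolution \<Rightarrow> 4 \<Rightarrow> 4" where
  "reconnect r i = (if (r = ResA) = (i \<in> {0, 2}) then i + 1 else i - 1)"

text \<open>
  The components of the crossing-free diagram obtained by resolving each crossing \<open>x\<close> according to
  \<open>\<sigma> x\<close>, each represented by the set of darts it runs through.
\<close>

definition circles :: "'x link_diagram \<Rightarrow> ('x \<Rightarrow> resolution) \<Rightarrow> 'x dart set set" where
  "circles D \<sigma> = components (darts D)
     ({(d, join D d) | d. d \<in> darts D} \<union>
      {((x, i), (x, reconnect (\<sigma> x) i)) | x i. x \<in> crossings D})"

record ('v, 'e) multigraph =
  verts :: "'v set"
  edges :: "'e set"
  ends :: "'e \<Rightarrow> 'v set"

definition loopless :: "('v, 'e) multigraph \<Rightarrow> bool" where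
  "loopless G \<longleftrightarrow> (\<forall>e\<in>edges G. \<not> (\<exists>v\<in>verts G. ends G e = {v}))"

definition state_graph ::
  "'x link_diagram \<Rightarrow> ('x \<Rightarrow> resolution) \<Rightarrow> ('x dart set, 'x) multigraph" where
  "state_graph D \<sigma> = \<lparr>verts = circles D \<sigma>, edges = crossings D,
     ends = (\<lambda>x. {C \<in> circles D \<sigma>. \<exists>i. (x, i) \<in> C})\<rparr>"

definition A_adequate :: "'x link_diagram \<Rightarrow> bool" where
  "A_adequate D \<longleftrightarrow> loopless (state_graph D (\<lambda>_. ResA))"

definition B_adequate :: "'x link_diagram \<Rightarrow> bool" where
  "B_adequate D \<longleftrightarrow> loopless (state_graph D (\<lambda>_. ResB))"

definition adequate :: "'x link_diagram \<Rightarrow> bool" where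
  "adequate D \<longleftrightarrow> A_adequate D \<and> B_adequate D"


section \<open>The Jones polynomial\<close>

text \<open>
  The Kauffman bracket, as a Laurent polynomial in \<open>A\<close> (the formal variable), normalised such that
  the crossing-free diagram of the unknot has bracket 1.
\<close>

definition kauffman_bracket :: "'x link_diagram \<Rightarrow> int fls" where
  "kauffman_bracket D =
     (\<Sum>\<sigma> \<in> crossings D \<rightarrow>\<^sub>E UNIV.
        fls_X_intpow (\<Sum>x\<in>crossings D. case \<sigma> x of ResA \<Rightarrow> 1 | ResB \<Rightarrow> - 1) *
        (- fls_X_intpow 2 - fls_X_intpow (- 2)) ^ (card (circles D \<sigma>) - 1))"

text \<open>
  If the understrand runs from dart 0 to dart 2, then the crossing is positive iff the overstrand
  runs from 3 to 1. Reversing both strands does not change the sign.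
\<close>

definition writhe :: "'x link_diagram \<Rightarrow> int" where
  "writhe D = (\<Sum>x\<in>crossings D. if outward D (x, 0) = outward D (x, 3) then 1 else - 1)"

text \<open>The product of the bracket with the power of \<open>- A\<^sup>3\<close> to the exponent \<open>- writhe D\<close>.\<close>

definition normalized_bracket :: "'x link_diagram \<Rightarrow> int fls" where
  "normalized_bracket D =
     (- 1) ^ nat \<bar>writhe D\<bar> * fls_X_intpow (- 3 * writhe D) * kauffman_bracket D"

text \<open>
  The Jones polynomial \<open>J\<^sub>K(t)\<close> of the link \<open>K\<close> with diagram \<open>D\<close> is the normalised bracket with
  \<open>t = A\<^sup>-\<^sup>4\<close>, so that \<open>jones_coeff D r\<close> is the coefficient of \<open>t\<^sup>r\<close>. The exponents \<open>r\<close> that occur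
  are integers or half-integers.
\<close>

definition jones_coeff :: "'x link_diagram \<Rightarrow> rat \<Rightarrow> int" where
  "jones_coeff D r =
     (if 4 * r \<in> \<int> then fls_nth (normalized_bracket D) (- \<lfloor>4 * r\<rfloor>) else 0)"

definition jones_max_exp :: "'x link_diagram \<Rightarrow> rat" where
  "jones_max_exp D = Max {r. jones_coeff D r \<noteq> 0}"

definition jones_min_exp :: "'x link_diagram \<Rightarrow> rat" where
  "jones_min_exp D = Min {r. jones_coeff D r \<noteq> 0}"

definition jones_second_coeff :: "'x link_diagram \<Rightarrow> int" where
  "jones_second_coeff D = jones_coeff D (jones_max_exp D - 1)"

definition jones_next_to_last_coeff :: "'x link_diagram \<Rightarrow> int" where
  "jones_next_to_last_coeff D = jones_coeff D (jones_min_exp D + 1)"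

end

theory Submission
  imports Defs
begin

text \<open>
  For \<open>\<rho> = A, B\<close>, let \<open>v\<^sub>\<rho>\<close> be the number of circles of the all-\<open>\<rho>\<close> state and \<open>e\<^sub>\<rho>\<close> the number of
  edges of its state graph after parallel edges have been identified. Up to sign, the second and the
  next-to-last coefficient of the Jones polynomial of an adequate diagram are the Betti numbers
  \<open>e\<^sub>\<rho> - v\<^sub>\<rho> + 1\<close> of the two reduced state graphs (\<open>abs_jones_second_coeff\<close>,
  \<open>abs_jones_next_to_last_coeff\<close>). To see this, obtain every state from the all-\<open>\<rho>\<close> state by flipping a
  set \<open>F\<close> of crossings. By adequacy, the first flip merges two circles, so no state with \<open>F \<noteq> {}\<close>
  reaches the extreme degree. In the next degree, \<open>F\<close> contributes iff each flip after the first splits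
  a circle. This holds if the edges in \<open>F\<close> are parallel (\<open>curves_flip_parallel\<close>) and only then
  (\<open>curves_flip_le_nonparallel\<close>), and the alternating sum over the nonempty sets of parallel edges
  counts the reduced edges.

  Planarity is used through Euler's formula for partially resolved diagrams (\<open>euler\<close>): the number of
  regions is one more than the number of crossings left plus the number of components. For a
  completely resolved diagram it says that the regions and the circles that separate them form a
  tree, which is the combinatorial form of the Jordan curve theorem.

  For the bounds, let \<open>c\<close> be the number of crossings and \<open>b\<close> the number of bigons. Since the diagram
  alternates in its twist regions, the bigons of a twist region are circles of the all-\<open>A\<close> state or
  circles of the all-\<open>B\<close> state; the twist region is called long for that resolution. As it has at least
  three crossings, its crossings are edges of the state graph that are not parallel to any other edge.
  In the other state graph, they are all parallel. So \<open>e\<^sub>A + e\<^sub>B = c + s\<^sub>A + s\<^sub>B\<close>, where \<open>s\<^sub>\<rho>\<close>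
  counts the classes of parallel edges that come from short twist regions, and the sum of the Betti
  numbers is \<open>c + s\<^sub>A + s\<^sub>B - v\<^sub>A - v\<^sub>B + 2\<close>. Moreover \<open>c - b = tw D\<close>, unless the bigons close up to
  one cycle.

  \<^item> The upper bound holds because \<open>s\<^sub>A + s\<^sub>B \<le> tw D\<close> and because each of the two states has, besides
    the bigons, at least one more circle. If the bigons close up to one cycle, then this fails for one
    of the states, but \<open>c = b\<close> makes up for it.
  \<^item> For the lower bound, let \<open>m\<close> be the number of circles of the state in which every crossing has its
    long resolution. Comparing its components with those of the diagrams in which one of the two types
    of crossings is put back gives \<open>v\<^sub>A + v\<^sub>B \<le> m + 1 + s\<^sub>A + s\<^sub>B\<close> (\<open>mixed_state_bound\<close>). Every circle
    that does not bound a bigon has at least three arcs (\<open>small_circle\<close>), so \<open>2 * b + 3 * (m - b) \<le> 2 * c\<close>.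
    Hence the sum is at least \<open>c - m + 1 \<ge> (c - b) / 3 + 1\<close>.
\<close>


section \<open>Counting the components of a relation\<close>

definition linked :: "'a set \<Rightarrow> ('a \<times> 'a) set \<Rightarrow> 'a \<Rightarrow> 'a \<Rightarrow> bool" where
  "linked S r a b \<longleftrightarrow> (a, b) \<in> ((r \<union> r\<inverse>) \<inter> S \<times> S)\<^sup>*"

definition ncomp :: "'a set \<Rightarrow> ('a \<times> 'a) set \<Rightarrow> nat" where
  "ncomp S r = card (components S r)"

lemma linked_refl [simp]: "linked S r a a"
  by (simp add: linked_def)

lemma linked_sym: "linked S r a b \<Longrightarrow> linked S r b a"
proof -
  have "sym (((r \<union> r\<inverse>) \<inter> S \<times> S)\<^sup>*)" by (rule sym_rtrancl) (auto simp: sym_def)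
  then show "linked S r a b \<Longrightarrow> linked S r b a" unfolding linked_def by (auto dest: symD)
qed

lemma linked_trans: "linked S r a b \<Longrightarrow> linked S r b c \<Longrightarrow> linked S r a c"
  unfolding linked_def by (rule rtrancl_trans)

lemma linked_cong: "linked S r a b \<Longrightarrow> linked S r a c \<longleftrightarrow> linked S r b c"
  using linked_trans linked_sym by metis

lemma linked_step: "(a, b) \<in> r \<Longrightarrow> a \<in> S \<Longrightarrow> b \<in> S \<Longrightarrow> linked S r a b"
  unfolding linked_def by auto

lemma linked_in: "linked S r a b \<Longrightarrow> a \<in> S \<Longrightarrow> b \<in> S"
  unfolding linked_def by (induction rule: rtrancl_induct) auto

lemma linked_induct [consumes 1, case_names refl step]:
  assumes "linked S r a b"
    and "P a"
    and "\<And>u v. linked S r a u \<Longrightarrow> P u \<Longrightarrow> (u, v) \<in> r \<or> (v, u) \<in> r \<Longrightarrow> u \<in> S \<Longrightarrow> v \<in> S \<Longrightarrow> P v"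
  shows "P b"
  using assms(1) unfolding linked_def
  by (induction rule: rtrancl_induct) (use assms(2,3) in \<open>auto simp: linked_def\<close>)

lemma linked_closed:
  assumes "linked S r a b" "a \<in> Q"
    and "\<And>u v. (u, v) \<in> r \<Longrightarrow> u \<in> S \<Longrightarrow> v \<in> S \<Longrightarrow> u \<in> Q \<longleftrightarrow> v \<in> Q"
  shows "b \<in> Q"
  using assms(1) by (induction rule: linked_induct) (use assms(2,3) in auto)

lemma linked_subrel:
  assumes "\<And>u v. (u, v) \<in> r \<Longrightarrow> u \<in> S \<Longrightarrow> v \<in> S \<Longrightarrow> linked S r' u v" and "linked S r a b"
  shows "linked S r' a b"
  using assms(2)
proof (induction rule: linked_induct)
  case (step u v)
  then have "linked S r' u v" using assms(1) linked_sym by metis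
  with step.IH show ?case by (rule linked_trans)
qed simp

lemma linked_mono: "r \<subseteq> r' \<Longrightarrow> linked S r a b \<Longrightarrow> linked S r' a b"
  by (rule linked_subrel[of r]) (auto intro: linked_step)

lemma linked_insert_iff:
  assumes "a \<in> S" "b \<in> S"
  shows "linked S (insert (a, b) r) u v \<longleftrightarrow>
    linked S r u v \<or> (linked S r u a \<and> linked S r b v) \<or> (linked S r u b \<and> linked S r a v)"
    (is "?L \<longleftrightarrow> ?R v")
proof
  assume ?L
  then show "?R v"
  proof (induction rule: linked_induct)
    case (step w v)
    then consider "linked S r w v" | "w = a" "v = b" | "w = b" "v = a"
      by (auto dest: linked_step linked_sym)
    then show ?case
      using step.IH by cases (meson linked_trans linked_sym linked_refl)+
  qed simp
next
  have ab: "linked S (insert (a, b) r) a b" using assms by (intro linked_step) auto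
  have m: "linked S r x y \<Longrightarrow> linked S (insert (a, b) r) x y" for x y
    by (rule linked_mono[rotated]) auto
  assume "?R v"
  then show ?L using ab m by (meson linked_trans linked_sym)
qed

lemma components_eq: "components S r = (\<lambda>a. {b. linked S r a b}) ` S"
  by (auto simp: components_def quotient_def Image_def linked_def)

lemma in_component: "C \<in> components S r \<Longrightarrow> a \<in> C \<Longrightarrow> C = {b. linked S r a b} \<and> a \<in> S"
  using linked_cong linked_in by (force simp: components_eq)

lemma component_subset: "C \<in> components S r \<Longrightarrow> C \<subseteq> S"
  using in_component by fast

lemma component_of_in: "a \<in> S \<Longrightarrow> {b. linked S r a b} \<in> components S r"
  by (auto simp: components_eq)

lemma component_of_eq_iff: "{x. linked S r a x} = {x. linked S r b x} \<longleftrightarrow> linked S r a b"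
proof
  assume "{x. linked S r a x} = {x. linked S r b x}"
  then have "linked S r a b \<longleftrightarrow> linked S r b b" by blast
  then show "linked S r a b" by simp
qed (auto dest: linked_cong)

lemma component_nonempty: "C \<in> components S r \<Longrightarrow> C \<noteq> {}"
  using linked_refl unfolding components_eq by (metis (no_types, lifting) empty_iff imageE mem_Collect_eq)

lemma component_closed:
  "C \<in> components S r \<Longrightarrow> a \<in> C \<Longrightarrow> linked S r a b \<Longrightarrow> b \<in> C"
  using in_component by fast

lemma components_disjoint:
  "C \<in> components S r \<Longrightarrow> C' \<in> components S r \<Longrightarrow> a \<in> C \<Longrightarrow> a \<in> C' \<Longrightarrow> C = C'"
  using in_component by metis

lemma Union_components: "\<Union>(components S r) = S"
  by (auto simp: components_eq intro: linked_in)

lemma finite_components: "finite S \<Longrightarrow> finite (components S r)"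
  by (simp add: components_eq)

lemma components_cong:
  assumes "\<And>a b. linked S r a b \<longleftrightarrow> linked S r' a b"
  shows "components S r = components S r'"
  using assms by (simp add: components_eq)

lemma components_cong':
  assumes "\<And>u v. (u, v) \<in> r \<Longrightarrow> u \<in> S \<Longrightarrow> v \<in> S \<Longrightarrow> linked S r' u v"
    and "\<And>u v. (u, v) \<in> r' \<Longrightarrow> u \<in> S \<Longrightarrow> v \<in> S \<Longrightarrow> linked S r u v"
  shows "components S r = components S r'"
  using linked_subrel[of r S r'] linked_subrel[of r' S r] assms by (intro components_cong) blast

lemma linked_of_components_eq:
  assumes "components S r = components S r'" "a \<in> S"
  shows "linked S r a b \<longleftrightarrow> linked S r' a b"
proof -
  have "{c. linked S r a c} = {c. linked S r' a c}"
    by (rule components_disjoint[of _ S r _ a])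
       (use component_of_in[of a S r] component_of_in[of a S r'] assms in auto)
  then show ?thesis by blast
qed

lemma sum_card_components:
  assumes "finite S" shows "(\<Sum>C\<in>components S r. card C) = card S"
proof -
  have "card (\<Union>(components S r)) = (\<Sum>C\<in>components S r. card C)"
  proof (rule card_Union_disjoint)
    show "pairwise disjnt (components S r)"
      unfolding pairwise_def disjnt_def by (auto dest: components_disjoint)
    show "finite C" if "C \<in> components S r" for C
      using component_subset[OF that] assms by (rule finite_subset)
  qed
  then show ?thesis by (simp add: Union_components)
qed

lemma ncomp_insert_linked: "linked S r a b \<Longrightarrow> ncomp S (insert (a, b) r) = ncomp S r"
  unfolding ncomp_def by (rule arg_cong[of _ _ card], rule components_cong')
    (auto intro: linked_step)

lemma ncomp_insert_unlinked:
  assumes "finite S" "a \<in> S" "b \<in> S" "\<not> linked S r a b"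
  shows "Suc (ncomp S (insert (a, b) r)) = ncomp S r"
proof -
  let ?c = "\<lambda>x. {y. linked S r x y}"
  have ab: "?c a \<noteq> ?c b" "?c a \<in> components S r" "?c b \<in> components S r"
    using assms by (auto simp: component_of_eq_iff component_of_in)
  have *: "{y. linked S (insert (a, b) r) x y} =
      (if linked S r x a \<or> linked S r x b then ?c a \<union> ?c b else ?c x)" for x
    unfolding linked_insert_iff[OF assms(2,3)] by (auto dest: linked_cong linked_sym)
  have "components S (insert (a, b) r) = insert (?c a \<union> ?c b) (components S r - {?c a, ?c b})"
  proof (intro equalityI subsetI)
    fix C assume "C \<in> components S (insert (a, b) r)"
    then obtain x where x: "x \<in> S" "C = {y. linked S (insert (a, b) r) x y}"
      by (auto simp: components_eq)
    show "C \<in> insert (?c a \<union> ?c b) (components S r - {?c a, ?c b})"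
      using x by (auto simp: * component_of_eq_iff component_of_in)
  next
    fix C assume C: "C \<in> insert (?c a \<union> ?c b) (components S r - {?c a, ?c b})"
    then consider "C = ?c a \<union> ?c b" | x where "x \<in> S" "C = ?c x" "?c x \<noteq> ?c a" "?c x \<noteq> ?c b"
      by (auto simp: components_eq)
    then show "C \<in> components S (insert (a, b) r)"
    proof cases
      case 1
      then have "C = {y. linked S (insert (a, b) r) a y}" by (simp add: *)
      then show ?thesis using assms(2) by (simp add: component_of_in)
    next
      case (2 x)
      then have "C = {y. linked S (insert (a, b) r) x y}" by (auto simp: * component_of_eq_iff)
      then show ?thesis using 2 by (simp add: component_of_in)
    qed
  qed
  moreover have "?c a \<union> ?c b \<notin> components S r"
  proof
    assume U: "?c a \<union> ?c b \<in> components S r"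
    have "?c a \<union> ?c b = ?c a" by (rule components_disjoint[OF U ab(2), of a]) auto
    moreover have "?c a \<union> ?c b = ?c b" by (rule components_disjoint[OF U ab(3), of b]) auto
    ultimately show False using ab(1) by metis
  qed
  moreover have "card (components S r - {?c a, ?c b}) = card (components S r) - 2"
    using ab assms(1) by (subst card_Diff_subset) (auto simp: finite_components)
  moreover have "card (components S r) \<ge> card {?c a, ?c b}"
    using ab assms(1) by (intro card_mono) (auto simp: finite_components)
  ultimately show ?thesis using ab(1) assms(1) by (simp add: ncomp_def finite_components)
qed

lemma ncomp_insert_le:
  assumes "finite S"
  shows "ncomp S (insert (a, b) r) \<le> ncomp S r" "ncomp S r \<le> Suc (ncomp S (insert (a, b) r))"
proof -
  have "ncomp S (insert (a, b) r) \<le> ncomp S r \<and> ncomp S r \<le> Suc (ncomp S (insert (a, b) r))"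
  proof (cases "a \<in> S \<and> b \<in> S \<and> \<not> linked S r a b")
    case True
    then show ?thesis using ncomp_insert_unlinked[OF assms, of a b r] by simp
  next
    case False
    have "components S (insert (a, b) r) = components S r"
      by (rule components_cong') (use False in \<open>auto intro: linked_step\<close>)
    then show ?thesis by (simp add: ncomp_def)
  qed
  then show "ncomp S (insert (a, b) r) \<le> ncomp S r" "ncomp S r \<le> Suc (ncomp S (insert (a, b) r))"
    by auto
qed

lemma ncomp_Un_le:
  assumes "finite S" "finite X"
  shows "ncomp S r \<le> ncomp S (r \<union> X) + card X"
  using assms(2)
proof (induction X)
  case (insert p X)
  have "ncomp S (r \<union> X) \<le> Suc (ncomp S (insert p (r \<union> X)))"
    using ncomp_insert_le(2)[OF assms(1)] by (cases p) blast
  then show ?case using insert by simp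
qed simp

text \<open>
  The number of components drops by less when a set of pairs is added to a larger relation,
  since a pair that is superfluous stays so when more is linked.
\<close>

lemma ncomp_supermodular:
  assumes "finite S" "finite X"
  shows "ncomp S (r \<union> t) + ncomp S (r \<union> X) \<le> ncomp S r + ncomp S (r \<union> t \<union> X)"
  using assms(2)
proof (induction X)
  case (insert p X)
  obtain a b where p: "p = (a, b)" by fastforce
  have "ncomp S (insert p (r \<union> X)) + ncomp S (r \<union> t \<union> X) \<le>
        ncomp S (r \<union> X) + ncomp S (insert p (r \<union> t \<union> X))"
  proof (cases "a \<in> S \<and> b \<in> S \<and> \<not> linked S (r \<union> t \<union> X) a b")
    case True
    then have "\<not> linked S (r \<union> X) a b"
      using linked_mono[of "r \<union> X" "r \<union> t \<union> X" S a b] by auto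
    then show ?thesis
      using True ncomp_insert_unlinked[OF assms(1), of a b "r \<union> t \<union> X"]
        ncomp_insert_unlinked[OF assms(1), of a b "r \<union> X"] p by simp
  next
    case False
    have "components S (insert p (r \<union> t \<union> X)) = components S (r \<union> t \<union> X)"
      by (rule components_cong') (use False p in \<open>auto intro: linked_step\<close>)
    then show ?thesis using ncomp_insert_le(1)[OF assms(1), of a b "r \<union> X"] p by (simp add: ncomp_def)
  qed
  then show ?case using insert by simp
qed simp

lemma ncomp_eq_1:
  assumes "a \<in> S" "\<And>b. b \<in> S \<Longrightarrow> linked S r a b"
  shows "ncomp S r = 1"
proof -
  have "{c. linked S r b c} = S" if "b \<in> S" for b
    using assms that linked_cong[OF assms(2)[OF that]] by (auto intro: linked_in)
  then have "components S r = {S}" using assms(1) by (auto simp: components_eq)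
  then show ?thesis by (simp add: ncomp_def)
qed

lemma even_card_involution:
  assumes "finite Q" "\<And>a. a \<in> Q \<Longrightarrow> f a \<in> Q \<and> f a \<noteq> a \<and> f (f a) = a"
  shows "even (card Q)"
  using assms
proof (induction "card Q" arbitrary: Q rule: less_induct)
  case less
  show ?case
  proof (cases "Q = {}")
    case False
    then obtain a where a: "a \<in> Q" by auto
    let ?R = "Q - {a, f a}"
    have c: "card Q = card ?R + 2"
      using less.prems(1) less.prems(2)[OF a] a card_mono[of Q "{a, f a}"]
      by (subst card_Diff_subset) auto
    have "f b \<in> ?R \<and> f b \<noteq> b \<and> f (f b) = b" if "b \<in> ?R" for b
      using less.prems(2)[of b] less.prems(2)[OF a] that by auto
    then have "even (card ?R)"
      using less.prems(1) c by (intro less.hyps) auto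
    then show ?thesis using c by simp
  qed simp
qed

section \<open>Corners of a crossing\<close>

lemma four_cases: "(i::4) = 0 \<or> i = 1 \<or> i = 2 \<or> i = 3"
proof (induct i)
  case (of_int z)
  then have "z = 0 \<or> z = 1 \<or> z = 2 \<or> z = 3" by auto
  then show ?case by auto
qed

lemma four_cases_from: "(k::4) = i \<or> k = i + 1 \<or> k = i + 2 \<or> k = i - 1"
  using four_cases[of i] four_cases[of k] by (elim disjE) simp_all

lemma four_simps [simp]:
  "(i::4) + 1 \<noteq> i" "(i::4) + 2 \<noteq> i" "(i::4) - 1 \<noteq> i" "(i::4) - 1 \<noteq> i + 1" "(i::4) + 1 \<noteq> i - 1"
  "(i::4) + 2 \<noteq> i + 1" "(i::4) + 1 \<noteq> i + 2" "(i::4) \<noteq> i + 1" "(i::4) \<noteq> i + 2" "(i::4) \<noteq> i - 1"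
  "(i::4) - 1 \<noteq> i + 2" "(i::4) + 2 \<noteq> i - 1"
  "(i::4) + 2 + 2 = i" "(i::4) + 1 + 1 = i + 2" "(i::4) - 1 - 1 = i + 2" "(i::4) + 2 + 1 = i - 1"
  "(i::4) + 2 - 1 = i + 1" "(i::4) + 1 + 2 = i - 1" "(i::4) - 1 + 2 = i + 1" "(i::4) + 3 = i - 1"
  using four_cases[of i] by (elim disjE; simp)+

fun opposite :: "resolution \<Rightarrow> resolution" where
  "opposite ResA = ResB"
| "opposite ResB = ResA"

lemma opposite_simps [simp]: "opposite (opposite \<rho>) = \<rho>" "opposite \<rho> \<noteq> \<rho>" "\<rho> \<noteq> opposite \<rho>"
  by (cases \<rho>; simp)+

lemma resolution_cases: "\<tau> = \<rho> \<or> \<tau> = opposite \<rho>"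
  by (cases \<rho>; cases \<tau>) simp_all

text \<open>
  The two arcs of a resolution cut off two opposite corners of the crossing, and the other two
  corners are merged.
\<close>

definition cuts :: "resolution \<Rightarrow> 4 \<Rightarrow> bool" where
  "cuts \<rho> i \<longleftrightarrow> reconnect \<rho> i = i + 1"

lemma reconnect_eq: "reconnect \<rho> i = (if cuts \<rho> i then i + 1 else i - 1)"
  by (simp add: cuts_def reconnect_def)

lemma cuts_iff: "cuts \<rho> i \<longleftrightarrow> (\<rho> = ResA) = (i \<in> {0, 2})"
  by (simp add: cuts_def reconnect_def)

lemma cuts_simps [simp]:
  "cuts \<rho> (i + 1) \<longleftrightarrow> \<not> cuts \<rho> i" "cuts \<rho> (i + 2) \<longleftrightarrow> cuts \<rho> i" "cuts \<rho> (i - 1) \<longleftrightarrow> \<not> cuts \<rho> i"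
  "cuts (opposite \<rho>) i \<longleftrightarrow> \<not> cuts \<rho> i"
     apply (cases \<rho>; use four_cases[of i] in \<open>elim disjE; simp add: cuts_iff\<close>)+
  done

lemma reconnect_simps [simp]:
  "reconnect \<rho> (reconnect \<rho> i) = i" "reconnect \<rho> i \<noteq> i"
  by (simp_all add: reconnect_eq)

lemma reconnect_add2 [simp]: "reconnect \<rho> (i + 2) = reconnect \<rho> i + 2"
  by (simp add: reconnect_eq)

lemma reconnect_eq_iff: "reconnect \<rho> i = reconnect \<rho> j \<longleftrightarrow> i = j"
  by (metis reconnect_simps(1))


section \<open>Curves and regions of a partially resolved diagram\<close>

locale connected_diagram =
  fixes D :: "'x link_diagram"
  assumes D: "link_diagram D"
begin

abbreviation "S \<equiv> darts D"
abbreviation "X \<equiv> crossings D"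

lemma in_darts [simp]: "(x, i) \<in> S \<longleftrightarrow> x \<in> X"
  by (simp add: darts_def)

lemma finite_X [simp]: "finite X" and X_nonempty: "X \<noteq> {}"
  using D by (auto simp: link_diagram_def)

lemma finite_S [simp]: "finite S"
  by (simp add: darts_def)

lemma card_S: "card S = 4 * card X"
  by (simp add: darts_def card_cartesian_product)

lemma join_in [simp]: "d \<in> S \<Longrightarrow> join D d \<in> S"
  and join_neq [simp]: "d \<in> S \<Longrightarrow> join D d \<noteq> d"
  and join_join [simp]: "d \<in> S \<Longrightarrow> join D (join D d) = d"
  using D by (auto simp: link_diagram_def)

lemma join_eq_iff: "d \<in> S \<Longrightarrow> e \<in> S \<Longrightarrow> join D d = join D e \<longleftrightarrow> d = e"
  by (metis join_join)

text \<open>The dart that has on its left what the given dart has on its right.\<close>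

definition rot :: "'x dart \<Rightarrow> 'x dart" where
  "rot d = (fst d, snd d - 1)"

lemma rot_pair [simp]: "rot (x, i) = (x, i - 1)"
  by (simp add: rot_def)

lemma rot_in [simp]: "rot d \<in> S \<longleftrightarrow> d \<in> S"
  by (cases d) simp

lemma next_side_eq: "next_side D d = rot (join D d)"
  by (simp add: next_side_def rot_def split: prod.split)

lemma next_side_in [simp]: "d \<in> S \<Longrightarrow> next_side D d \<in> S"
  by (simp add: next_side_eq)

text \<open>
  In a partially resolved diagram, the crossings in \<open>U\<close> are still there and the others are resolved
  according to \<open>\<sigma>\<close>. The components of \<open>curve_rel \<sigma> U\<close> are its connected components, each represented
  by the set of its darts. The components of \<open>region_rel \<sigma> U\<close> are its regions, each represented by
  the set of those darts that have it on their left; resolving a crossing merges two opposite corners.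
  Since the arcs of a resolution already link the darts of a crossing in pairs, one more pair links all
  four of them if the crossing is in \<open>U\<close>, whatever \<open>\<sigma>\<close> is there.
\<close>

definition curve_rel :: "('x \<Rightarrow> resolution) \<Rightarrow> 'x set \<Rightarrow> ('x dart \<times> 'x dart) set" where
  "curve_rel \<sigma> U = {(d, join D d) | d. d \<in> S} \<union>
     {((x, i), (x, reconnect (\<sigma> x) i)) | x i. x \<in> X} \<union> {((x, i), (x, i + 2)) | x i. x \<in> U}"

definition region_rel :: "('x \<Rightarrow> resolution) \<Rightarrow> 'x set \<Rightarrow> ('x dart \<times> 'x dart) set" where
  "region_rel \<sigma> U = {(d, next_side D d) | d. d \<in> S} \<union>
     {((x, i), (x, i + 2)) | x i. x \<in> X - U \<and> \<not> cuts (\<sigma> x) i}"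

abbreviation "curve_linked \<sigma> U \<equiv> linked S (curve_rel \<sigma> U)"
abbreviation "region_linked \<sigma> U \<equiv> linked S (region_rel \<sigma> U)"
abbreviation "curves \<sigma> U \<equiv> ncomp S (curve_rel \<sigma> U)"
abbreviation "faces \<sigma> U \<equiv> ncomp S (region_rel \<sigma> U)"

lemma circles_eq: "circles D \<sigma> = components S (curve_rel \<sigma> {})"
  by (simp add: circles_def curve_rel_def)

lemma card_circles: "card (circles D \<sigma>) = curves \<sigma> {}"
  by (simp add: circles_eq ncomp_def)

lemma faces_all: "faces \<sigma> X = card X + 2"
  using D by (simp add: link_diagram_def ncomp_def region_rel_def regions_def)

lemma curve_rel_intros:
  "d \<in> S \<Longrightarrow> (d, join D d) \<in> curve_rel \<sigma> U"
  "x \<in> X \<Longrightarrow> ((x, i), (x, reconnect (\<sigma> x) i)) \<in> curve_rel \<sigma> U"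
  "x \<in> U \<Longrightarrow> ((x, i), (x, i + 2)) \<in> curve_rel \<sigma> U"
  unfolding curve_rel_def by blast+

lemma region_rel_intros:
  "d \<in> S \<Longrightarrow> (d, next_side D d) \<in> region_rel \<sigma> U"
  "x \<in> X \<Longrightarrow> x \<notin> U \<Longrightarrow> \<not> cuts (\<sigma> x) i \<Longrightarrow> ((x, i), (x, i + 2)) \<in> region_rel \<sigma> U"
  unfolding region_rel_def by blast+

lemma curve_linked_join: "d \<in> S \<Longrightarrow> curve_linked \<sigma> U d (join D d)"
  by (rule linked_step) (auto intro: curve_rel_intros)

lemma curve_linked_reconnect: "x \<in> X \<Longrightarrow> curve_linked \<sigma> U (x, i) (x, reconnect (\<sigma> x) i)"
  by (rule linked_step) (auto intro: curve_rel_intros)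

lemma region_linked_next_side: "d \<in> S \<Longrightarrow> region_linked \<sigma> U d (rot (join D d))"
  unfolding next_side_eq[symmetric] by (rule linked_step) (auto intro: region_rel_intros)

lemma region_linked_corner:
  "x \<in> X \<Longrightarrow> x \<notin> U \<Longrightarrow> \<not> cuts (\<sigma> x) i \<Longrightarrow> region_linked \<sigma> U (x, i) (x, i + 2)"
  by (rule linked_step) (auto intro: region_rel_intros)

lemma linked_at_crossing:
  assumes "\<And>k. linked S r (x, k) (x, reconnect \<rho> k)" "linked S r (x, i) (x, i + 2)"
  shows "linked S r (x, k) (x, l)"
proof -
  have r: "linked S r (x, reconnect \<rho> i) (x, reconnect \<rho> i + 2)"
    using linked_trans[OF linked_sym[OF assms(1)[of i]] linked_trans[OF assms(2) assms(1)[of "i + 2"]]]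
    by simp
  have "linked S r (x, i) (x, j)" for j
  proof -
    consider "j = i" | "j = i + 2" | "j = reconnect \<rho> i" | "j = reconnect \<rho> i + 2"
      using four_cases_from[of j i] by (cases "cuts \<rho> i") (auto simp: reconnect_eq)
    then show ?thesis
      using r assms(1)[of i] assms(2) by cases (auto intro: linked_trans)
  qed
  then show ?thesis using linked_cong linked_sym by metis
qed

lemma linked_at_unresolved:
  assumes "x \<in> X" "x \<in> U"
  shows "curve_linked \<sigma> U (x, k) (x, l)"
proof (rule linked_at_crossing[where \<rho> = "\<sigma> x" and i = 0])
  show "curve_linked \<sigma> U (x, 0) (x, 0 + 2)"
    using assms curve_rel_intros(3)[of x U 0] by (intro linked_step) auto
qed (simp add: curve_linked_reconnect assms)

lemma curve_linked_all:
  assumes "d \<in> S" "e \<in> S" shows "curve_linked \<sigma> X d e"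
proof -
  have *: "(x, y) \<in> (adjacent D)\<^sup>* \<Longrightarrow> x \<in> X \<Longrightarrow> curve_linked \<sigma> X (x, i) (y, j) \<and> y \<in> X" for x y i j
  proof (induction arbitrary: j rule: rtrancl_induct)
    case base
    then show ?case using linked_at_unresolved[of x X] by simp
  next
    case (step y z)
    from step.hyps obtain k l where kl: "(y, k) \<in> S" "join D (y, k) = (z, l)"
      by (auto simp: adjacent_def)
    then have "(z, l) \<in> S" by (metis join_in)
    moreover have "curve_linked \<sigma> X (y, k) (z, l)" using curve_linked_join[OF kl(1)] kl(2) by metis
    ultimately show ?case
      using step.IH[OF step.prems, of k] linked_at_unresolved[of z X \<sigma> l j]
      by (auto intro: linked_trans)
  qed
  obtain x i y j where d: "d = (x, i)" "e = (y, j)" by fastforce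
  moreover have "(x, y) \<in> (adjacent D)\<^sup>*"
    using D assms unfolding d link_diagram_def by simp
  ultimately show ?thesis using * assms by simp
qed

lemma curves_all: "curves \<sigma> X = 1"
proof -
  obtain x where "x \<in> X" using X_nonempty by auto
  then show ?thesis by (intro ncomp_eq_1[of "(x, 0)"] curve_linked_all) auto
qed

lemma components_curve_insert:
  assumes "x \<in> X"
  shows "components S (curve_rel \<sigma> (insert x U)) =
    components S (insert ((x, i), (x, i + 2)) (curve_rel \<sigma> U))" (is "_ = components S ?r")
proof (rule components_cong')
  have at: "linked S ?r (x, k) (x, l)" for k l
    by (rule linked_at_crossing[of _ _ "\<sigma> x" i])
       (use assms in \<open>auto intro!: linked_step curve_rel_intros\<close>)
  show "linked S ?r u v" if uv: "(u, v) \<in> curve_rel \<sigma> (insert x U)" "u \<in> S" "v \<in> S" for u v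
  proof (cases "(u, v) \<in> curve_rel \<sigma> U")
    case False
    then obtain j where "u = (x, j)" "v = (x, j + 2)" using uv unfolding curve_rel_def by blast
    then show ?thesis using at by simp
  qed (use uv in \<open>auto intro: linked_step\<close>)
  have "?r \<subseteq> curve_rel \<sigma> (insert x U)" unfolding curve_rel_def by blast
  then show "linked S (curve_rel \<sigma> (insert x U)) u v" if "(u, v) \<in> ?r" "u \<in> S" "v \<in> S" for u v
    using that by (intro linked_step) auto
qed

lemma components_region_resolve:
  assumes "x \<in> X" "x \<notin> U" "\<not> cuts (\<sigma> x) m"
  shows "components S (region_rel \<sigma> U) =
    components S (insert ((x, m), (x, m + 2)) (region_rel \<sigma> (insert x U)))" (is "_ = components S ?r")
proof (rule components_cong')
  have m: "linked S ?r (x, m) (x, m + 2)" using assms by (intro linked_step) auto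
  show "linked S ?r u v" if uv: "(u, v) \<in> region_rel \<sigma> U" "u \<in> S" "v \<in> S" for u v
  proof (cases "(u, v) \<in> region_rel \<sigma> (insert x U)")
    case False
    then obtain j where j: "u = (x, j)" "v = (x, j + 2)" "\<not> cuts (\<sigma> x) j"
      using uv unfolding region_rel_def by blast
    then have "j = m \<or> j = m + 2"
      using assms(3) four_cases_from[of j m] by auto
    then show ?thesis using j m linked_sym[OF m] by auto
  qed (use uv in \<open>auto intro: linked_step\<close>)
  show "region_linked \<sigma> U u v" if "(u, v) \<in> ?r" "u \<in> S" "v \<in> S" for u v
    using that assms unfolding region_rel_def by (intro linked_step) blast+
qed

text \<open>
  Walk along the boundary of the region with the corner \<open>(x, i + 1)\<close>. If the two arcs at \<open>x\<close> belong
  to different components, then the walk can leave the component that it starts in only by passing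
  the opposite corner \<open>(x, i - 1)\<close>.
\<close>

lemma opposite_corners_linked:
  assumes x: "x \<in> X" "x \<notin> U" and i: "cuts (\<sigma> x) i" and sep: "\<not> curve_linked \<sigma> U (x, i) (x, i + 2)"
  shows "region_linked \<sigma> (insert x U) (x, i + 1) (x, i - 1)"
proof (rule ccontr)
  assume nl: "\<not> region_linked \<sigma> (insert x U) (x, i + 1) (x, i - 1)"
  define g where "g d = (case join D d of (y, j) \<Rightarrow>
    if y \<in> insert x U then (y, j - 1) else (y, reconnect (\<sigma> y) j))" for d
  define Q where "Q = {e. curve_linked \<sigma> U (x, i) e \<and> region_linked \<sigma> (insert x U) (x, i + 1) e}"
  have QS: "Q \<subseteq> S" using x by (auto simp: Q_def intro: linked_in)
  have g_inj: "inj_on g S"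
  proof (rule inj_onI)
    fix d e assume de: "d \<in> S" "e \<in> S" "g d = g e"
    then have "join D d = join D e"
      by (auto simp: g_def reconnect_eq_iff split: prod.splits if_splits)
    then show "d = e" using de by (simp add: join_eq_iff)
  qed
  have g_region: "region_linked \<sigma> (insert x U) d (g d)" if d: "d \<in> S" for d
  proof -
    obtain y j where yj: "join D d = (y, j)" by fastforce
    then have y: "y \<in> X" using join_in[OF d] by simp
    have "region_linked \<sigma> (insert x U) d (y, j - 1)"
      using region_linked_next_side[OF d] yj by (metis rot_pair)
    moreover have "region_linked \<sigma> (insert x U) (y, j - 1) (g d)"
      using yj y region_linked_corner[of y "insert x U" \<sigma> "j - 1"]
      by (auto simp: g_def reconnect_eq)
    ultimately show ?thesis by (rule linked_trans)
  qed
  have xi: "curve_linked \<sigma> U (x, i) (x, i + 1)"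
    using curve_linked_reconnect[OF x(1), of \<sigma> U i] i by (simp add: reconnect_eq)
  have sep': "\<not> curve_linked \<sigma> U (x, i) (x, i - 1)"
    using curve_linked_reconnect[OF x(1), of \<sigma> U "i + 2"] i sep
    by (auto simp: reconnect_eq dest: linked_sym linked_trans)
  have g_curve: "curve_linked \<sigma> U (x, i) (g d)" if d: "d \<in> Q" for d
  proof -
    obtain y j where yj: "join D d = (y, j)" by fastforce
    have dS: "d \<in> S" using d QS by auto
    then have y: "y \<in> X" using join_in[OF dS] yj by simp
    have *: "curve_linked \<sigma> U (x, i) (y, j)"
      using d curve_linked_join[OF dS, of \<sigma> U] yj by (auto simp: Q_def intro: linked_trans)
    consider "y \<in> U" | "y = x" | "y \<notin> insert x U" by auto
    then show ?thesis
    proof cases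
      case 1
      then show ?thesis using * yj linked_at_unresolved[OF y 1, of \<sigma> j "j - 1"]
        by (auto simp: g_def intro: linked_trans)
    next
      case 2
      have "(x, i - 1) \<noteq> g d"
        using nl g_region[OF dS] d by (auto simp: Q_def intro: linked_trans)
      then have "j = i + 1"
        using four_cases_from[of j i] * 2 sep sep' yj by (auto simp: g_def)
      then show ?thesis using yj 2 by (simp add: g_def)
    next
      case 3
      then show ?thesis using * yj curve_linked_reconnect[OF y, of \<sigma> U j]
        by (auto simp: g_def intro: linked_trans)
    qed
  qed
  have gQ: "g ` Q \<subseteq> Q"
  proof (rule image_subsetI)
    fix d assume d: "d \<in> Q"
    then have "region_linked \<sigma> (insert x U) (x, i + 1) (g d)"
      using linked_trans[OF _ g_region[of d]] subsetD[OF QS d] unfolding Q_def by blast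
    then show "g d \<in> Q" using g_curve[OF d] by (simp add: Q_def)
  qed
  have "g ` Q = Q"
    by (rule endo_inj_surj) (use gQ g_inj QS in \<open>auto intro: finite_subset inj_on_subset\<close>)
  moreover have "(x, i + 1) \<in> Q" using xi by (simp add: Q_def)
  ultimately obtain d where d: "d \<in> Q" "g d = (x, i + 1)" by (metis imageE)
  have dS: "d \<in> S" using d QS by auto
  obtain y j where yj: "join D d = (y, j)" by fastforce
  then have "y = x" "j - 1 = i + 1" using d(2) by (auto simp: g_def split: if_splits)
  then have "join D d = (x, i + 2)"
    using yj by (metis diff_add_cancel four_simps(14))
  then show False
    using d(1) curve_linked_join[OF dS, of \<sigma> U] sep by (auto simp: Q_def intro: linked_trans)
qed

text \<open>
  Hence resolving a crossing cannot both disconnect a component and merge two regions.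
\<close>

lemma resolve_step:
  assumes x: "x \<in> X" "x \<notin> U"
  shows "curves \<sigma> U + faces \<sigma> (insert x U) \<le> 1 + curves \<sigma> (insert x U) + faces \<sigma> U"
proof -
  obtain i where i: "cuts (\<sigma> x) i" using cuts_simps(1) by metis
  have c: "curves \<sigma> (insert x U) = ncomp S (insert ((x, i), (x, i + 2)) (curve_rel \<sigma> U))"
    unfolding ncomp_def by (simp add: components_curve_insert[OF x(1), of \<sigma> U i])
  have f: "faces \<sigma> U = ncomp S (insert ((x, i + 1), (x, i - 1)) (region_rel \<sigma> (insert x U)))"
    using components_region_resolve[OF x, of \<sigma> "i + 1"] i by (simp add: ncomp_def)
  show ?thesis
  proof (cases "curve_linked \<sigma> U (x, i) (x, i + 2)")
    case True
    then show ?thesis using ncomp_insert_linked[OF True] c f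
        ncomp_insert_le(2)[of S "region_rel \<sigma> (insert x U)" "(x, i + 1)" "(x, i - 1)"] by simp
  next
    case False
    then show ?thesis using ncomp_insert_linked[OF opposite_corners_linked[OF x i False]] c f
        ncomp_insert_le(2)[of S "curve_rel \<sigma> U" "(x, i)" "(x, i + 2)"] by simp
  qed
qed

text \<open>
  Resolve the crossings one by one, starting from the diagram itself, for which equality holds because
  it lies on a sphere.
\<close>

lemma euler_ge:
  assumes "U \<subseteq> X" shows "card U + curves \<sigma> U + 1 \<le> faces \<sigma> U"
proof -
  have "card (X - W) + curves \<sigma> (X - W) + 1 \<le> faces \<sigma> (X - W)" if "finite W" "W \<subseteq> X" for W
    using that
  proof (induction W)
    case empty
    then show ?case by (simp add: faces_all curves_all)
  next
    case (insert x W)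
    define U where "U = X - insert x W"
    have x: "x \<in> X" "x \<notin> U" and U: "X - W = insert x U" "finite U"
      using insert.prems insert.hyps by (auto simp: U_def)
    have "card U + 1 + curves \<sigma> (insert x U) + 1 \<le> faces \<sigma> (insert x U)"
      using insert U x by simp
    then show ?case using resolve_step[OF x, of \<sigma>] by (simp add: U_def)
  qed
  from this[of "X - U"] show ?thesis using assms by (simp add: double_diff)
qed


section \<open>The tree of regions and circles\<close>

text \<open>
  The darts on a circle point in both directions along it, so the left side of one of them may be the
  right side of another.
\<close>

definition same_sides where
  "same_sides r d e \<longleftrightarrow> (linked S r d e \<and> linked S r (rot d) (rot e)) \<or>
     (linked S r d (rot e) \<and> linked S r (rot d) e)"

lemma same_sides_trans: "same_sides r a b \<Longrightarrow> same_sides r b c \<Longrightarrow> same_sides r a c"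
  unfolding same_sides_def
  by (elim disjE conjE; ((rule disjI1, rule conjI; erule (1) linked_trans) |
      (rule disjI2, rule conjI; erule (1) linked_trans)))

lemma same_sides_sym: "same_sides r a b \<Longrightarrow> same_sides r b a"
  unfolding same_sides_def by (auto dest: linked_sym)

lemma same_sides_mono: "r \<subseteq> r' \<Longrightarrow> same_sides r a b \<Longrightarrow> same_sides r' a b"
  unfolding same_sides_def using linked_mono[of r r'] by blast

lemma same_sides_linked: "same_sides r a b \<Longrightarrow> linked S r a (rot a) \<Longrightarrow> linked S r b (rot b)"
  unfolding same_sides_def using linked_cong[of S r a] linked_sym[of S r] by blast

lemma sides_join: "d \<in> S \<Longrightarrow> region_linked \<sigma> U d (rot (join D d)) \<and> region_linked \<sigma> U (rot d) (join D d)"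
  using region_linked_next_side[of d \<sigma> U] region_linked_next_side[of "join D d" \<sigma> U]
  by (auto intro: linked_sym)

lemma sides_reconnect:
  assumes "x \<in> X" "x \<notin> U"
  shows "region_linked \<sigma> U (x, i) (rot (x, reconnect (\<sigma> x) i)) \<and>
    region_linked \<sigma> U (rot (x, i)) (x, reconnect (\<sigma> x) i)"
  using region_linked_corner[of x U \<sigma> i] region_linked_corner[of x U \<sigma> "i - 1"] assms
  by (auto simp: reconnect_eq)

lemma circle_same_sides:
  assumes "curve_linked \<sigma> {} d e" shows "same_sides (region_rel \<sigma> {}) d e"
  using assms
proof (induction rule: linked_induct)
  case (step u v)
  have *: "same_sides (region_rel \<sigma> {}) a b" if "(a, b) \<in> curve_rel \<sigma> {}" for a b
  proof -
    from that consider "a \<in> S" "b = join D a"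
      | x i where "x \<in> X" "a = (x, i)" "b = (x, reconnect (\<sigma> x) i)"
      unfolding curve_rel_def by blast
    then show ?thesis
      by cases (use sides_join[of a \<sigma> "{}"] sides_reconnect[of _ "{}" \<sigma>] in
        \<open>simp_all add: same_sides_def del: rot_pair\<close>)
  qed
  have "same_sides (region_rel \<sigma> {}) u v"
    using step.hyps(2) *[of u v] same_sides_sym[OF *[of v u]] by blast
  with step.IH show ?case by (rule same_sides_trans)
qed (simp add: same_sides_def)

text \<open>
  Consider the graph whose vertices are the regions of a completely resolved diagram and whose edges
  are the circles. If the circles in \<open>\<C>\<close> connect all regions that some circle separates, then they
  connect all regions, since the diagram is connected.
\<close>

lemma faces_le_card_circles:
  assumes "\<C> \<subseteq> circles D \<sigma>"
    and "\<And>d. d \<in> S \<Longrightarrow> d \<notin> \<Union>\<C> \<Longrightarrow>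
      linked S (region_rel \<sigma> {} \<union> {(e, rot e) | e. e \<in> \<Union>\<C>}) d (rot d)"
  shows "faces \<sigma> {} \<le> card \<C> + 1"
proof -
  define p where "p = (\<lambda>C. SOME d :: 'x dart. d \<in> C)"
  define Y where "Y = (\<lambda>C. (p C, rot (p C))) ` \<C>"
  let ?r = "region_rel \<sigma> {} \<union> Y"
  have fin: "finite \<C>"
    using assms(1) finite_components[OF finite_S] unfolding circles_eq by (rule finite_subset)
  have p: "p C \<in> C" if "C \<in> \<C>" for C
    using component_nonempty[of C S "curve_rel \<sigma> {}"] that assms(1)
    unfolding p_def circles_eq by (metis someI_ex subsetD ex_in_conv)
  have 1: "linked S ?r e (rot e)" if e: "e \<in> C" and C: "C \<in> \<C>" for e C
  proof -
    have C': "C \<in> components S (curve_rel \<sigma> {})" using C assms(1) by (auto simp: circles_eq)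
    have "curve_linked \<sigma> {} (p C) e" and pS: "p C \<in> S"
      using in_component[OF C' p[OF C]] e by auto
    then have "same_sides ?r (p C) e"
      using same_sides_mono[OF _ circle_same_sides] by blast
    moreover have "linked S ?r (p C) (rot (p C))"
      using C pS by (intro linked_step) (auto simp: Y_def)
    ultimately show ?thesis by (rule same_sides_linked)
  qed
  have rot: "linked S ?r d (rot d)" if "d \<in> S" for d
  proof (cases "d \<in> \<Union>\<C>")
    case False
    show ?thesis
      by (rule linked_subrel[OF _ assms(2)[OF that False]]) (use 1 in \<open>auto intro: linked_step\<close>)
  qed (use 1 in blast)
  have at: "linked S ?r (x, i) (x, j)" if "x \<in> X" for x i j
  proof -
    have 2: "linked S ?r (x, k) (x, k - 1)" for k using rot[of "(x, k)"] that by simp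
    have "linked S ?r (x, k) (x, k + 2)" for k
      using linked_trans[OF linked_sym[OF 2[of "k + 1"]]] linked_sym[OF 2[of "k + 2"]]
      by (metis add_diff_cancel_right' four_simps(17))
    then show ?thesis
      using four_cases_from[of j i] 2 linked_sym[OF 2[of "i + 1"]] by auto
  qed
  have "linked S ?r a b" if "curve_linked \<sigma> X a b" for a b
    using _ that
  proof (rule linked_subrel)
    fix u v assume uv: "(u, v) \<in> curve_rel \<sigma> X" "u \<in> S" "v \<in> S"
    show "linked S ?r u v"
    proof (cases "v = join D u")
      case True
      have "linked S ?r u (rot (join D u))"
        using sides_join[OF uv(2), of \<sigma> "{}"] linked_mono[of _ ?r] by blast
      then show ?thesis
        using True linked_trans[OF _ linked_sym[OF rot[OF uv(3)]]] by simp
    next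
      case False
      then obtain x i j where "u = (x, i)" "v = (x, j)" using uv(1) unfolding curve_rel_def by blast
      then show ?thesis using at uv(2) by simp
    qed
  qed
  then have "ncomp S ?r = 1"
    using X_nonempty curve_linked_all by (metis ex_in_conv in_darts ncomp_eq_1)
  moreover have "faces \<sigma> {} \<le> ncomp S ?r + card Y"
    by (rule ncomp_Un_le) (use fin in \<open>auto simp: Y_def\<close>)
  moreover have "card Y \<le> card \<C>" using fin by (simp add: Y_def card_image_le)
  ultimately show ?thesis by simp
qed

lemma faces_le_curves: "faces \<sigma> {} \<le> curves \<sigma> {} + 1"
proof -
  have "\<Union>(circles D \<sigma>) = S" by (simp add: circles_eq Union_components)
  then show ?thesis using faces_le_card_circles[of "circles D \<sigma>" \<sigma>] by (simp add: card_circles)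
qed

text \<open>
  One inequality is inherited by diagrams with more crossings resolved, so the converse one, which
  holds when all crossings are resolved, holds before as well.
\<close>

theorem euler:
  assumes "U \<subseteq> X" shows "faces \<sigma> U = card U + curves \<sigma> U + 1"
proof -
  have "finite U" using assms finite_X by (rule finite_subset)
  then have "faces \<sigma> U \<le> card U + curves \<sigma> U + 1" using assms
  proof (induction U)
    case empty
    then show ?case using faces_le_curves by simp
  next
    case (insert x U)
    then show ?case using resolve_step[of x U \<sigma>] by simp
  qed
  then show ?thesis using euler_ge[OF assms, of \<sigma>] by simp
qed

text \<open>
  By Euler's formula, the connected graph of regions and circles has one more vertex than edges. So it
  is a tree, and it becomes disconnected without the edge \<open>C\<close>. In particular, it has neither loops
  (\<open>sides_distinct\<close>) nor double edges (\<open>same_sides_imp_same_circle\<close>).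
\<close>

lemma circles_needed:
  assumes "C \<in> circles D \<sigma>"
  obtains d where "d \<in> C" "\<not> linked S (region_rel \<sigma> {} \<union> {(e, rot e) | e. e \<in> S - C}) d (rot d)"
proof (rule ccontr)
  note obtain_d = that
  assume "\<not> thesis"
  then have *: "linked S (region_rel \<sigma> {} \<union> {(e, rot e) | e. e \<in> S - C}) d (rot d)" if "d \<in> C" for d
    using that obtain_d by blast
  have fin: "finite (circles D \<sigma>)" by (simp add: circles_eq finite_components)
  have U: "\<Union>(circles D \<sigma> - {C}) = S - C"
    using Union_components[of S "curve_rel \<sigma> {}"] components_disjoint[of _ S "curve_rel \<sigma> {}" C] assms
    unfolding circles_eq by blast
  have "faces \<sigma> {} \<le> card (circles D \<sigma> - {C}) + 1"
    by (rule faces_le_card_circles) (use * in \<open>auto simp: U\<close>)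
  moreover have "card (circles D \<sigma>) > 0" using assms fin by (auto simp: card_gt_0_iff)
  ultimately show False using euler[of "{}" \<sigma>] assms fin by (simp add: card_circles[symmetric])
qed

lemma sides_distinct:
  assumes "d \<in> S" shows "\<not> region_linked \<sigma> {} d (rot d)"
proof
  assume d: "region_linked \<sigma> {} d (rot d)"
  let ?C = "{e. curve_linked \<sigma> {} d e}"
  have "?C \<in> circles D \<sigma>" using component_of_in[OF assms] by (simp add: circles_eq)
  then obtain e where e: "curve_linked \<sigma> {} d e"
      "\<not> linked S (region_rel \<sigma> {} \<union> {(e, rot e) | e. e \<in> S - ?C}) e (rot e)"
    by (rule circles_needed) simp
  have "region_linked \<sigma> {} e (rot e)"
    using same_sides_linked[OF circle_same_sides[OF e(1)] d] .
  then show False using e(2) linked_mono[of "region_rel \<sigma> {}"] by blast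
qed

lemma same_sides_imp_same_circle:
  assumes "d \<in> S" "e \<in> S" "same_sides (region_rel \<sigma> {}) d e"
  shows "curve_linked \<sigma> {} d e"
proof (rule ccontr)
  assume nl: "\<not> curve_linked \<sigma> {} d e"
  let ?C = "{f. curve_linked \<sigma> {} e f}"
  let ?r = "region_rel \<sigma> {} \<union> {(e, rot e) | e. e \<in> S - ?C}"
  have "?C \<in> circles D \<sigma>" using component_of_in[OF assms(2)] by (simp add: circles_eq)
  then obtain f where f: "curve_linked \<sigma> {} e f" "\<not> linked S ?r f (rot f)"
    by (rule circles_needed) simp
  have "same_sides ?r d f"
    by (rule same_sides_mono[OF _ same_sides_trans[OF assms(3) circle_same_sides[OF f(1)]]]) auto
  moreover have "linked S ?r d (rot d)"
  proof (rule linked_step)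
    have "d \<in> S - ?C" using assms(1) nl linked_sym[of S "curve_rel \<sigma> {}" e d] by blast
    then show "(d, rot d) \<in> ?r" by blast
  qed (use assms(1) in auto)
  ultimately show False using f(2) same_sides_linked by blast
qed

section \<open>Flipping the resolution of a crossing\<close>

lemma curve_linked_cong:
  assumes "\<And>x. x \<in> X - U \<Longrightarrow> \<sigma> x = \<tau> x"
  shows "curve_linked \<sigma> U d e \<longleftrightarrow> curve_linked \<tau> U d e"
proof -
  have "curve_linked \<tau> U d e" if "curve_linked \<sigma> U d e" "\<And>x. x \<in> X - U \<Longrightarrow> \<sigma> x = \<tau> x"
    for \<sigma> \<tau> d e
    using _ that(1)
  proof (rule linked_subrel)
    fix u v assume uv: "(u, v) \<in> curve_rel \<sigma> U" "u \<in> S" "v \<in> S"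
    show "curve_linked \<tau> U u v"
    proof (cases "\<exists>x i. x \<in> U \<and> u = (x, i) \<and> v = (x, reconnect (\<sigma> x) i)")
      case True
      then show ?thesis using linked_at_unresolved uv(2) by auto
    next
      case False
      then have "(u, v) \<in> curve_rel \<tau> U" using uv that(2) unfolding curve_rel_def by fastforce
      then show ?thesis using uv by (auto intro: linked_step)
    qed
  qed
  from this[of \<sigma> d e \<tau>] this[of \<tau> d e \<sigma>] show ?thesis using assms by auto
qed

lemma curves_cong:
  assumes "\<And>x. x \<in> X - U \<Longrightarrow> \<sigma> x = \<tau> x" shows "curves \<sigma> U = curves \<tau> U"
  unfolding ncomp_def using components_cong[OF curve_linked_cong[OF assms]] by simp

lemma curves_insert:
  assumes "x \<in> X"
  shows "curves \<sigma> (insert x U) \<le> curves \<sigma> U" "curves \<sigma> U \<le> Suc (curves \<sigma> (insert x U))"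
    and "curve_linked \<sigma> U (x, i) (x, i + 2) \<Longrightarrow> curves \<sigma> (insert x U) = curves \<sigma> U"
    and "\<not> curve_linked \<sigma> U (x, i) (x, i + 2) \<Longrightarrow> Suc (curves \<sigma> (insert x U)) = curves \<sigma> U"
proof -
  have *: "curves \<sigma> (insert x U) = ncomp S (insert ((x, i), (x, i + 2)) (curve_rel \<sigma> U))" for i
    unfolding ncomp_def by (simp add: components_curve_insert[OF assms, of \<sigma> U i])
  show "curves \<sigma> (insert x U) \<le> curves \<sigma> U" "curves \<sigma> U \<le> Suc (curves \<sigma> (insert x U))"
    unfolding *[of 0] by (rule ncomp_insert_le; simp)+
  show "curve_linked \<sigma> U (x, i) (x, i + 2) \<Longrightarrow> curves \<sigma> (insert x U) = curves \<sigma> U"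
    unfolding *[of i] by (rule ncomp_insert_linked)
  show "\<not> curve_linked \<sigma> U (x, i) (x, i + 2) \<Longrightarrow> Suc (curves \<sigma> (insert x U)) = curves \<sigma> U"
    unfolding *[of i] using assms by (intro ncomp_insert_unlinked) auto
qed

text \<open>
  If the diagram is cut open at \<open>x\<close>, then the circles turn into circles and two arcs with endpoints
  at \<open>x\<close>.
\<close>

definition open_rel :: "('x \<Rightarrow> resolution) \<Rightarrow> 'x \<Rightarrow> ('x dart \<times> 'x dart) set" where
  "open_rel \<sigma> x = {(d, join D d) | d. d \<in> S} \<union>
     {((y, i), (y, reconnect (\<sigma> y) i)) | y i. y \<in> X - {x}}"

text \<open>
  Edges pair up the darts of a component of the open diagram, and arcs pair up those that are not at
  \<open>x\<close>. So the number of its darts at \<open>x\<close> is even.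
\<close>

lemma open_arc_other_end:
  assumes "x \<in> X"
  obtains k where "k \<noteq> i" "linked S (open_rel \<sigma> x) (x, i) (x, k)"
proof -
  define Q where "Q = {e. linked S (open_rel \<sigma> x) (x, i) e}"
  define Q' where "Q' = {e \<in> Q. fst e = x}"
  have QS: "Q \<subseteq> S" using assms by (auto simp: Q_def intro: linked_in)
  have fin: "finite Q" using QS finite_S by (rule finite_subset)
  have closed: "b \<in> Q" if "a \<in> Q" "(a, b) \<in> open_rel \<sigma> x" "b \<in> S" for a b
    using that QS linked_trans[OF _ linked_step[of a b]] unfolding Q_def by blast
  have "even (card Q)"
    using fin
  proof (rule even_card_involution)
    fix a assume a: "a \<in> Q"
    then have "a \<in> S" using QS by auto
    then show "join D a \<in> Q \<and> join D a \<noteq> a \<and> join D (join D a) = a"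
      using closed[OF a, of "join D a"] unfolding open_rel_def
      by (metis (mono_tags, lifting) UnI1 join_in join_join join_neq mem_Collect_eq)
  qed
  moreover have "even (card (Q - Q'))"
  proof (rule even_card_involution[where f = "\<lambda>(y, j). (y, reconnect (\<sigma> y) j)"])
    fix a assume a: "a \<in> Q - Q'"
    obtain y j where y: "a = (y, j)" by fastforce
    then have "y \<noteq> x" "y \<in> X" using a QS by (auto simp: Q'_def)
    then show "(case a of (y, j) \<Rightarrow> (y, reconnect (\<sigma> y) j)) \<in> Q - Q' \<and>
        (case a of (y, j) \<Rightarrow> (y, reconnect (\<sigma> y) j)) \<noteq> a \<and>
        (case case a of (y, j) \<Rightarrow> (y, reconnect (\<sigma> y) j) of (y, j) \<Rightarrow> (y, reconnect (\<sigma> y) j)) = a"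
      using a y closed[of "(y, j)" "(y, reconnect (\<sigma> y) j)"] unfolding open_rel_def Q'_def by auto
  qed (use fin in simp)
  moreover have "card Q = card (Q - Q') + card Q'"
    using card_Int_Diff[OF fin, of Q'] by (simp add: Q'_def Int_def conj_commute)
  ultimately have "even (card Q')" by simp
  moreover have "(x, i) \<in> Q'" by (simp add: Q'_def Q_def)
  ultimately have "Q' \<noteq> {(x, i)}" by auto
  then obtain k where "k \<noteq> i" "(x, k) \<in> Q'"
    using \<open>(x, i) \<in> Q'\<close> unfolding Q'_def by fastforce
  then show thesis using that by (simp add: Q'_def Q_def)
qed

lemma open_rel_linked:
  assumes "linked S (open_rel \<sigma> x) d e" "\<And>y. y \<in> X - {x} \<Longrightarrow> \<sigma> y = \<tau> y"
  shows "curve_linked \<tau> U d e"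
proof (rule linked_mono[OF _ assms(1)])
  show "open_rel \<sigma> x \<subseteq> curve_rel \<tau> U"
    using assms(2) unfolding open_rel_def curve_rel_def by fastforce
qed

text \<open>
  If the arcs at \<open>x\<close> lie on different circles, then each of the two open arcs leads back to the other
  end of its arc at \<open>x\<close>, so the opposite resolution merges the circles.
\<close>

lemma flip_merges:
  assumes x: "x \<in> X" and sep: "\<not> curve_linked \<sigma> {} (x, i) (x, i + 2)"
    and \<tau>: "\<tau> x = opposite (\<sigma> x)" "\<And>y. y \<in> X - {x} \<Longrightarrow> \<tau> y = \<sigma> y"
  shows "curve_linked \<tau> {} (x, k) (x, l)"
proof -
  let ?j = "reconnect (\<sigma> x) i"
  obtain k where k: "k \<noteq> i" "linked S (open_rel \<sigma> x) (x, i) (x, k)"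
    using open_arc_other_end[OF x] .
  have "\<not> curve_linked \<sigma> {} (x, i) (x, ?j + 2)"
    using sep curve_linked_reconnect[OF x, of \<sigma> "{}" "?j + 2"] by (auto dest: linked_trans)
  then have "k = ?j"
    using k(1) open_rel_linked[OF k(2), of \<sigma> "{}"] sep four_cases_from[of k i]
    by (auto simp: reconnect_eq split: if_splits)
  then have "curve_linked \<tau> {} (x, i) (x, ?j)" using open_rel_linked[OF k(2)] \<tau>(2) by simp
  moreover have "curve_linked \<tau> {} (x, ?j) (x, i + 2)"
    using curve_linked_reconnect[OF x, of \<tau> "{}" ?j] \<tau>(1)
    by (cases "cuts (\<sigma> x) i") (simp_all add: reconnect_eq)
  ultimately have "curve_linked \<tau> {} (x, i) (x, i + 2)" by (rule linked_trans)
  then show ?thesis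
    by (rule linked_at_crossing[where \<rho> = "\<tau> x", rotated]) (simp add: curve_linked_reconnect x)
qed

lemma flip_merges_linked:
  assumes x: "x \<in> X" and sep: "\<not> curve_linked \<sigma> {} (x, i) (x, i + 2)"
    and \<tau>: "\<tau> x = opposite (\<sigma> x)" "\<And>y. y \<in> X - {x} \<Longrightarrow> \<tau> y = \<sigma> y"
  shows "curve_linked \<tau> {} d e \<longleftrightarrow> curve_linked \<sigma> {x} d e"
proof -
  have "curve_linked \<sigma> {x} d e \<longleftrightarrow> curve_linked \<tau> {x} d e" using \<tau>(2) by (intro curve_linked_cong) simp
  also have "\<dots> \<longleftrightarrow> curve_linked \<tau> {} d e"
  proof
    assume "curve_linked \<tau> {x} d e"
    then show "curve_linked \<tau> {} d e"
    proof (rule linked_subrel[rotated])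
      fix u v assume uv: "(u, v) \<in> curve_rel \<tau> {x}" "u \<in> S" "v \<in> S"
      then have "(u, v) \<in> curve_rel \<tau> {} \<or> (\<exists>k l. u = (x, k) \<and> v = (x, l))"
        unfolding curve_rel_def by blast
      then show "curve_linked \<tau> {} u v"
        using flip_merges[OF assms] uv by (auto intro: linked_step)
    qed
  next
    assume "curve_linked \<tau> {} d e"
    then show "curve_linked \<tau> {x} d e"
      by (rule linked_mono[rotated]) (auto simp: curve_rel_def)
  qed
  finally show ?thesis by simp
qed

lemma flip_merges_curves:
  assumes x: "x \<in> X" and sep: "\<not> curve_linked \<sigma> {} (x, i) (x, i + 2)"
    and \<tau>: "\<tau> x = opposite (\<sigma> x)" "\<And>y. y \<in> X - {x} \<Longrightarrow> \<tau> y = \<sigma> y"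
  shows "Suc (curves \<tau> {}) = curves \<sigma> {}"
  using components_cong[OF flip_merges_linked[OF assms]] curves_insert(4)[OF x sep]
  by (simp add: ncomp_def)

lemma flip_curves_le:
  assumes x: "x \<in> X" and \<tau>: "\<And>y. y \<in> X - {x} \<Longrightarrow> \<tau> y = \<sigma> y"
  shows "curves \<tau> {} \<le> Suc (curves \<sigma> {})"
  using curves_insert(2)[OF x, of \<tau> "{}"] curves_insert(1)[OF x, of \<sigma> "{}"]
    curves_cong[of "{x}" \<tau> \<sigma>] \<tau> by simp

text \<open>
  A crossing with the same region at two opposite corners is nugatory: Euler's formula says that
  separating the corners cuts the diagram into two parts, so the opposite resolution has only one
  circle at the crossing.
\<close>

lemma nugatory_one_circle:
  assumes x: "x \<in> X" and i: "cuts (\<sigma> x) i" and r: "region_linked \<sigma> X (x, i + 1) (x, i - 1)"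
    and \<tau>: "\<tau> x = opposite (\<sigma> x)"
  shows "curve_linked \<tau> {} (x, k) (x, l)"
proof -
  let ?U = "X - {x}"
  have XU: "X = insert x ?U" using x by auto
  have "components S (region_rel \<sigma> ?U) = components S (insert ((x, i + 1), (x, i - 1)) (region_rel \<sigma> X))"
    using components_region_resolve[of x ?U \<sigma> "i + 1"] x i XU by simp
  then have "faces \<sigma> ?U = card X + 2"
    using ncomp_insert_linked[OF r] faces_all by (simp add: ncomp_def)
  moreover have "card X > 0" using x by (auto simp: card_gt_0_iff)
  ultimately have "curves \<sigma> ?U = 2" using euler[of ?U \<sigma>] x by simp
  then have sep: "\<not> curve_linked \<sigma> ?U (x, i) (x, i + 2)"
    using curves_insert(3)[OF x, of \<sigma> ?U i] curves_all[of \<sigma>] XU by auto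
  then have sep': "\<not> curve_linked \<sigma> ?U (x, i) (x, i - 1)"
    using curve_linked_reconnect[OF x, of \<sigma> ?U "i + 2"] i by (auto simp: reconnect_eq dest: linked_sym linked_trans)
  obtain k where k: "k \<noteq> i" "linked S (open_rel \<tau> x) (x, i) (x, k)"
    using open_arc_other_end[OF x] .
  have "curve_linked \<sigma> ?U (x, i) (x, k)"
    using _ k(2)
  proof (rule linked_subrel)
    fix u v assume uv: "(u, v) \<in> open_rel \<tau> x" "u \<in> S" "v \<in> S"
    show "curve_linked \<sigma> ?U u v"
    proof (cases "v = join D u")
      case True
      then show ?thesis using curve_linked_join uv(2) by simp
    next
      case False
      then obtain y j l where "y \<in> ?U" "u = (y, j)" "v = (y, l)"
        using uv(1) unfolding open_rel_def by blast
      then show ?thesis using linked_at_unresolved[of y ?U] by simp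
    qed
  qed
  then have "k = i + 1" using k(1) sep sep' four_cases_from[of k i] by auto
  then have "curve_linked \<tau> {} (x, i) (x, i + 1)" using open_rel_linked[OF k(2)] by simp
  moreover have "curve_linked \<tau> {} (x, i + 1) (x, i + 2)"
    using curve_linked_reconnect[OF x, of \<tau> "{}" "i + 1"] \<tau> i by (simp add: reconnect_eq)
  ultimately have "curve_linked \<tau> {} (x, i) (x, i + 2)" by (rule linked_trans)
  then show ?thesis
    by (rule linked_at_crossing[where \<rho> = "\<tau> x", rotated]) (simp add: curve_linked_reconnect x)
qed

end

section \<open>Circle counts of the states of an adequate diagram\<close>

locale adequate_diagram = connected_diagram +
  assumes adequate: "adequate D"
begin

definition circ :: "resolution \<Rightarrow> 'a dart \<Rightarrow> 'a dart set" where
  "circ \<rho> d = {e. curve_linked (\<lambda>_. \<rho>) {} d e}"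

lemma in_circ: "e \<in> circ \<rho> d \<longleftrightarrow> curve_linked (\<lambda>_. \<rho>) {} d e"
  by (simp add: circ_def)

lemma circ_eq_iff: "circ \<rho> d = circ \<rho> e \<longleftrightarrow> curve_linked (\<lambda>_. \<rho>) {} d e"
  unfolding circ_def by (rule component_of_eq_iff)

lemma circ_in_circles: "d \<in> S \<Longrightarrow> circ \<rho> d \<in> circles D (\<lambda>_. \<rho>)"
  unfolding circles_eq circ_def by (rule component_of_in)

lemma circles_separated:
  assumes x: "x \<in> X" shows "\<not> curve_linked (\<lambda>_. \<rho>) {} (x, i) (x, i + 2)"
proof
  assume *: "curve_linked (\<lambda>_. \<rho>) {} (x, i) (x, i + 2)"
  have all: "curve_linked (\<lambda>_. \<rho>) {} (x, 0) (x, j)" for j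
    by (rule linked_at_crossing[OF _ *, where \<rho> = \<rho>])
       (use curve_linked_reconnect[OF x, of "\<lambda>_. \<rho>"] in simp)
  have "C = circ \<rho> (x, 0)" if "C \<in> circles D (\<lambda>_. \<rho>)" "(x, j) \<in> C" for C j
  proof (rule components_disjoint)
    show "C \<in> components S (curve_rel (\<lambda>_. \<rho>) {})" using that(1) by (simp only: circles_eq)
    show "circ \<rho> (x, 0) \<in> components S (curve_rel (\<lambda>_. \<rho>) {})"
      using circ_in_circles[of "(x, 0)" \<rho>] x by (simp only: circles_eq in_darts)
    show "(x, j) \<in> circ \<rho> (x, 0)" using all by (simp only: in_circ)
  qed (rule that(2))
  moreover have c: "circ \<rho> (x, 0) \<in> circles D (\<lambda>_. \<rho>)" "(x, 0) \<in> circ \<rho> (x, 0)"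
    using x by (simp_all only: circ_in_circles in_darts in_circ linked_refl)
  ultimately have "{C \<in> circles D (\<lambda>_. \<rho>). \<exists>j. (x, j) \<in> C} = {circ \<rho> (x, 0)}"
    by (intro equalityI subsetI) (blast, blast)
  moreover have "loopless (state_graph D (\<lambda>_. \<rho>))"
    using adequate by (cases \<rho>) (simp_all add: adequate_def A_adequate_def B_adequate_def)
  ultimately show False
    using c(1) x unfolding loopless_def state_graph_def by auto
qed

lemma circ_reconnect: "x \<in> X \<Longrightarrow> circ \<rho> (x, reconnect \<rho> i) = circ \<rho> (x, i)"
  using curve_linked_reconnect[of x "\<lambda>_. \<rho>" "{}" i] unfolding circ_eq_iff by (rule linked_sym)

lemma circ_join: "d \<in> S \<Longrightarrow> circ \<rho> (join D d) = circ \<rho> d"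
  using curve_linked_join[of d "\<lambda>_. \<rho>" "{}"] unfolding circ_eq_iff by (rule linked_sym)

text \<open>The ends of \<open>x\<close> as an edge of the state graph; \<open>ends_at \<rho> ` X\<close> is the reduced edge set.\<close>

definition ends_at :: "resolution \<Rightarrow> 'a \<Rightarrow> 'a dart set set" where
  "ends_at \<rho> x = {circ \<rho> (x, 0), circ \<rho> (x, 2)}"

lemma ends_at_eq:
  assumes "x \<in> X" shows "ends_at \<rho> x = {circ \<rho> (x, i), circ \<rho> (x, i + 2)}"
proof -
  have "{circ \<rho> (x, j), circ \<rho> (x, j + 2)} = {circ \<rho> (x, k), circ \<rho> (x, k + 2)}" for j k
  proof (cases "cuts \<rho> j")
    case True
    then have "circ \<rho> (x, j + 1) = circ \<rho> (x, j)" "circ \<rho> (x, j - 1) = circ \<rho> (x, j + 2)"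
      using circ_reconnect[OF assms, of \<rho> j] circ_reconnect[OF assms, of \<rho> "j + 2"]
      by (simp_all add: reconnect_eq)
    then show ?thesis using four_cases_from[of k j] by (elim disjE; simp add: insert_commute)
  next
    case False
    then have "circ \<rho> (x, j - 1) = circ \<rho> (x, j)" "circ \<rho> (x, j + 1) = circ \<rho> (x, j + 2)"
      using circ_reconnect[OF assms, of \<rho> j] circ_reconnect[OF assms, of \<rho> "j + 2"]
      by (simp_all add: reconnect_eq)
    then show ?thesis using four_cases_from[of k j] by (elim disjE; simp add: insert_commute)
  qed
  from this[of 0 i] show ?thesis by (simp add: ends_at_def)
qed

definition flip :: "resolution \<Rightarrow> 'a set \<Rightarrow> 'a \<Rightarrow> resolution" where
  "flip \<rho> F x = (if x \<in> F then opposite \<rho> else \<rho>)"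

lemma flip_empty [simp]: "flip \<rho> {} = (\<lambda>_. \<rho>)"
  by (simp add: flip_def fun_eq_iff)

lemma curves_flip_mono:
  assumes "F \<subseteq> G" "G \<subseteq> X"
  shows "curves (flip \<rho> G) {} \<le> curves (flip \<rho> F) {} + card (G - F)"
proof -
  have "curves (flip \<rho> (F \<union> H)) {} \<le> curves (flip \<rho> F) {} + card H" if "finite H" "H \<subseteq> X" for H
    using that
  proof (induction H)
    case (insert x H)
    have "curves (flip \<rho> (F \<union> insert x H)) {} \<le> Suc (curves (flip \<rho> (F \<union> H)) {})"
      by (rule flip_curves_le[of x]) (use insert.prems in \<open>auto simp: flip_def\<close>)
    then show ?case using insert by simp
  qed simp
  from this[of "G - F"] show ?thesis
    using assms finite_subset[OF assms(2)] by (auto simp: Un_absorb1)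
qed

lemma curves_flip_single:
  assumes "x \<in> X" shows "Suc (curves (flip \<rho> {x}) {}) = curves (\<lambda>_. \<rho>) {}"
  by (rule flip_merges_curves[OF assms circles_separated[OF assms, of \<rho> 0]]) (auto simp: flip_def)

text \<open>By adequacy, the first flip merges two circles, and each further flip adds at most one.\<close>

lemma curves_flip_le:
  assumes "F \<subseteq> X" "F \<noteq> {}"
  shows "curves (flip \<rho> F) {} + 2 \<le> curves (\<lambda>_. \<rho>) {} + card F"
proof -
  obtain x where x: "x \<in> F" using assms(2) by auto
  have "finite F" using assms(1) finite_X by (rule finite_subset)
  then have "card F = Suc (card (F - {x}))" using x by (rule card.remove)
  then show ?thesis
    using curves_flip_mono[of "{x}" F \<rho>] curves_flip_single[of x \<rho>] x assms by auto
qed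

text \<open>
  If the flipped crossings do not all join the same two circles, then two of them can be flipped
  such that both flips merge circles.
\<close>

lemma curves_flip_le_nonparallel:
  assumes F: "F \<subseteq> X" and x: "x \<in> F" and y: "y \<in> F" and ne: "ends_at \<rho> x \<noteq> ends_at \<rho> y"
  shows "curves (flip \<rho> F) {} + 4 \<le> curves (\<lambda>_. \<rho>) {} + card F"
proof -
  have X: "x \<in> X" "y \<in> X" and xy: "x \<noteq> y" and fin: "finite F"
    using assms finite_subset[OF F] by auto
  let ?r = "curve_rel (\<lambda>_. \<rho>) {}"
  have "\<not> linked S (insert ((x, 0), (x, 0 + 2)) ?r) (y, 0) (y, 2)"
  proof
    assume "linked S (insert ((x, 0), (x, 0 + 2)) ?r) (y, 0) (y, 2)"
    then consider "linked S ?r (y, 0) (y, 0 + 2)"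
      | "linked S ?r (y, 0) (x, 0)" "linked S ?r (x, 2) (y, 2)"
      | "linked S ?r (y, 0) (x, 2)" "linked S ?r (x, 0) (y, 2)"
      using linked_insert_iff[of "(x, 0)" S "(x, 0 + 2)" ?r "(y, 0)" "(y, 2)"] X by auto
    then show False
    proof cases
      case 1
      then show ?thesis using circles_separated[OF X(2)] by blast
    next
      case 2
      then have "circ \<rho> (y, 0) = circ \<rho> (x, 0)" "circ \<rho> (x, 2) = circ \<rho> (y, 2)"
        by (simp_all only: circ_eq_iff)
      then show ?thesis using ne by (simp add: ends_at_def)
    next
      case 3
      then have "circ \<rho> (y, 0) = circ \<rho> (x, 2)" "circ \<rho> (x, 0) = circ \<rho> (y, 2)"
        by (simp_all only: circ_eq_iff)
      then show ?thesis using ne by (simp add: ends_at_def insert_commute)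
    qed
  qed
  then have "\<not> curve_linked (\<lambda>_. \<rho>) {x} (y, 0) (y, 2)"
    using linked_of_components_eq[OF components_curve_insert[OF X(1), of "\<lambda>_. \<rho>" "{}" 0], of "(y, 0)"] X
    by simp
  then have "\<not> curve_linked (flip \<rho> {x}) {} (y, 0) (y, 0 + 2)"
    using flip_merges_linked[OF X(1) circles_separated[OF X(1), of \<rho> 0], of "flip \<rho> {x}"]
    by (simp add: flip_def)
  then have "Suc (curves (flip \<rho> {x, y}) {}) = curves (flip \<rho> {x}) {}"
    by (rule flip_merges_curves[OF X(2)]) (use xy in \<open>auto simp: flip_def\<close>)
  moreover have "curves (flip \<rho> F) {} \<le> curves (flip \<rho> {x, y}) {} + card (F - {x, y})"
    by (rule curves_flip_mono) (use x y F in auto)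
  moreover have "card (F - {x, y}) + 2 = card F"
    using xy x y fin card_mono[of F "{x, y}"] by (subst card_Diff_subset) auto
  ultimately show ?thesis using curves_flip_single[OF X(1), of \<rho>] by simp
qed

lemma curve_rel_cases:
  assumes "(u, v) \<in> curve_rel \<sigma> {} \<or> (v, u) \<in> curve_rel \<sigma> {}" "u \<in> S" "v \<in> S"
  obtains "v = join D u" | z k where "z \<in> X" "u = (z, k)" "v = (z, reconnect (\<sigma> z) k)"
proof -
  have *: "b = join D a \<or> (\<exists>z k. a = (z, k) \<and> b = (z, reconnect (\<sigma> z) k))"
    if "(a, b) \<in> curve_rel \<sigma> {}" for a b
    using that unfolding curve_rel_def by blast
  note joined = that(1) and reconn = that(2)
  from assms(1) show thesis
  proof
    assume "(u, v) \<in> curve_rel \<sigma> {}"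
    from *[OF this] show thesis using that assms(2) by auto
  next
    assume "(v, u) \<in> curve_rel \<sigma> {}"
    from *[OF this] show thesis
    proof (elim disjE exE conjE)
      show thesis if "u = join D v" using that assms(3) joined by simp
      show thesis if "v = (z, k)" "u = (z, reconnect (\<sigma> z) k)" for z k
        using that assms(3) reconn[of z "reconnect (\<sigma> z) k"] by simp
    qed
  qed
qed

text \<open>
  Two crossings that join the same circles do so on the same side of each of them, because no two
  circles separate the same two regions.
\<close>

lemma parallel_same_side:
  assumes X: "x \<in> X" "z \<in> X" and ij: "cuts \<rho> i" "cuts \<rho> j"
    and 1: "curve_linked (\<lambda>_. \<rho>) {} (x, i) (z, j)"
    and 2: "curve_linked (\<lambda>_. \<rho>) {} (x, i + 2) (z, j + 2)"
  shows "region_linked (\<lambda>_. \<rho>) {} (x, i) (z, j)"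
proof (rule ccontr)
  let ?R = "region_linked (\<lambda>_. \<rho>) {}"
  assume n: "\<not> ?R (x, i) (z, j)"
  have x: "?R (x, i - 1) (x, i + 1)" and z: "?R (z, j - 1) (z, j + 1)"
    using region_linked_corner[of x "{}" "\<lambda>_. \<rho>" "i - 1"] region_linked_corner[of z "{}" "\<lambda>_. \<rho>" "j - 1"]
      X ij by auto
  have a: "?R (x, i) (z, j - 1)" "?R (x, i - 1) (z, j)"
    using circle_same_sides[OF 1] n by (auto simp: same_sides_def)
  have "same_sides (region_rel (\<lambda>_. \<rho>) {}) (x, i + 2) (z, j + 2)"
    using circle_same_sides[OF 2] .
  then consider "?R (x, i + 1) (z, j + 1)" | "?R (x, i + 2) (z, j + 1)"
    by (auto simp: same_sides_def)
  then show False
  proof cases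
    case 1
    then have "?R (x, i) (x, i - 1)"
      using linked_trans[OF linked_trans[OF a(1) z] linked_sym[OF linked_trans[OF x]]] by blast
    then show ?thesis using sides_distinct[of "(x, i)"] X by simp
  next
    case 2
    then have "?R (x, i) (x, i + 2)" using linked_trans[OF linked_trans[OF a(1) z] linked_sym] by blast
    then have "same_sides (region_rel (\<lambda>_. \<rho>) {}) (x, i) (x, i + 2)"
      using x by (simp add: same_sides_def)
    then show ?thesis
      using same_sides_imp_same_circle[OF _ _ \<open>same_sides _ (x, i) (x, i + 2)\<close>]
        circles_separated[OF X(1), of \<rho> i] X by simp
  qed
qed

text \<open>
  Hence the crossings in \<open>F\<close> all lie on the same side of each of the two circles. On the other side,
  the circle can be followed by means of corners that are merged at crossings outside \<open>F\<close>, so putting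
  the crossings in \<open>F\<close> back does not cut the region there.
\<close>

lemma parallel_outer_linked:
  assumes F: "F \<subseteq> X" "x \<in> F" and i: "cuts \<rho> i"
    and par: "\<And>z. z \<in> F \<Longrightarrow> \<exists>j. cuts \<rho> j \<and> curve_linked (\<lambda>_. \<rho>) {} (x, i) (z, j) \<and>
      curve_linked (\<lambda>_. \<rho>) {} (x, i + 2) (z, j + 2)"
    and d: "curve_linked (\<lambda>_. \<rho>) {} (x, i) d"
    and e: "e = d \<or> e = rot d" "region_linked (\<lambda>_. \<rho>) {} (x, i) e"
  shows "region_linked (\<lambda>_. \<rho>) F (x, i) e"
proof -
  let ?R = "region_linked (\<lambda>_. \<rho>) {} (x, i)" and ?T = "region_linked (\<lambda>_. \<rho>) F (x, i)"
  have xS: "(x, i) \<in> S" using F by auto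
  have carry: "?T b" if "?R a \<longrightarrow> ?T a" "region_linked (\<lambda>_. \<rho>) {} a b"
    "region_linked (\<lambda>_. \<rho>) F a b" "?R b" for a b
    using linked_trans[OF mp[OF that(1) linked_trans[OF that(4) linked_sym[OF that(2)]]] that(3)] .
  have "\<forall>e. e = d \<or> e = rot d \<longrightarrow> ?R e \<longrightarrow> ?T e"
    using d
  proof (induction rule: linked_induct)
    case refl
    show ?case using sides_distinct[OF xS] by auto
  next
    case (step u v)
    show ?case
    proof (intro allI impI)
      fix e assume e: "e = v \<or> e = rot v" "?R e"
      from step.hyps(2,3,4) show "?T e"
      proof (cases rule: curve_rel_cases)
        case 1
        then show ?thesis
          using e carry[of u "rot v"] carry[of "rot u" v] step.IH
            sides_join[OF \<open>u \<in> S\<close>, of "\<lambda>_. \<rho>" "{}"] sides_join[OF \<open>u \<in> S\<close>, of "\<lambda>_. \<rho>" F] by blast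
      next
        case (2 z k)
        show ?thesis
        proof (cases "z \<in> F")
          case False
          then show ?thesis
            using e carry[of u "rot v"] carry[of "rot u" v] step.IH 2
              sides_reconnect[of z "{}" "\<lambda>_. \<rho>" k] sides_reconnect[of z F "\<lambda>_. \<rho>" k] by blast
        next
          case True
          then obtain j where j: "cuts \<rho> j" "curve_linked (\<lambda>_. \<rho>) {} (x, i) (z, j)"
              "curve_linked (\<lambda>_. \<rho>) {} (x, i + 2) (z, j + 2)" using par by blast
          \<comment> \<open>the corner that the circle cuts off at \<open>z\<close> lies on the side that is followed\<close>
          have h: "?R (z, j)"
            using parallel_same_side[OF _ _ i j] F 2 by auto
          have "circ \<rho> (z, k) = circ \<rho> (z, j)"
            using linked_trans[OF linked_sym[OF step.hyps(1)] j(2)] 2(2) unfolding circ_eq_iff by simp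
          moreover have "circ \<rho> (z, j + 2) \<noteq> circ \<rho> (z, j)"
            using circles_separated[OF \<open>z \<in> X\<close>, of \<rho> j] circ_eq_iff[of \<rho> "(z, j)" "(z, j + 2)"] by simp
          moreover have "circ \<rho> (z, j - 1) = circ \<rho> (z, j + 2)"
            using circ_reconnect[OF \<open>z \<in> X\<close>, of \<rho> "j + 2"] j(1) by (simp add: reconnect_eq)
          ultimately have "k = j \<or> k = j + 1" using four_cases_from[of k j] by auto
          then have uv: "u = (z, j) \<and> v = (z, j + 1) \<or> u = (z, j + 1) \<and> v = (z, j)"
            using 2 j(1) by (auto simp: reconnect_eq)
          have "e = (z, j)"
          proof (rule ccontr)
            assume "e \<noteq> (z, j)"
            moreover have "region_linked (\<lambda>_. \<rho>) {} e (z, j)"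
              using linked_trans[OF linked_sym[OF e(2)] h] .
            ultimately have "region_linked (\<lambda>_. \<rho>) {} v (rot v)"
              using e(1) uv linked_sym by auto
            then show False using sides_distinct[OF \<open>v \<in> S\<close>] by simp
          qed
          then show ?thesis using step.IH h uv by auto
        qed
      qed
    qed
  qed
  then show ?thesis using e by blast
qed

text \<open>
  Flipping crossings that all join the same two circles merges these with the first flip, and each
  further flip splits off a circle: by Euler's formula, the two circles and the crossings between
  them bound \<open>card F\<close> regions, and the flips merge the outer sides of the two circles.
\<close>

lemma curves_flip_parallel:
  assumes F: "F \<subseteq> X" "F \<noteq> {}" and par: "\<And>x y. x \<in> F \<Longrightarrow> y \<in> F \<Longrightarrow> ends_at \<rho> x = ends_at \<rho> y"
  shows "curves (flip \<rho> F) {} + 2 = curves (\<lambda>_. \<rho>) {} + card F"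
proof (rule antisym)
  obtain x where x: "x \<in> F" using F(2) by auto
  obtain i where i: "cuts \<rho> i" using cuts_simps(1) by metis
  have xX: "x \<in> X" using x F by auto
  let ?C = "curve_linked (\<lambda>_. \<rho>) {}" and ?T = "region_linked (\<lambda>_. \<rho>) F"
  have "\<exists>j. cuts \<rho> j \<and> ?C (x, i) (z, j) \<and> ?C (x, i + 2) (z, j + 2)" if z: "z \<in> F" for z
  proof -
    have "z \<in> X" using z F by auto
    then have "{circ \<rho> (x, i), circ \<rho> (x, i + 2)} = {circ \<rho> (z, i), circ \<rho> (z, i + 2)}"
      using par[OF x z] ends_at_eq[OF xX, of \<rho> i] ends_at_eq[of z \<rho> i] by simp
    then have "?C (x, i) (z, i) \<and> ?C (x, i + 2) (z, i + 2) \<or>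
        ?C (x, i) (z, i + 2) \<and> ?C (x, i + 2) (z, i)"
      unfolding doubleton_eq_iff circ_eq_iff .
    then show ?thesis
    proof
      assume "?C (x, i) (z, i) \<and> ?C (x, i + 2) (z, i + 2)"
      then show ?thesis using i by blast
    next
      assume "?C (x, i) (z, i + 2) \<and> ?C (x, i + 2) (z, i)"
      then show ?thesis using i by (intro exI[of _ "i + 2"]) simp
    qed
  qed
  then obtain j where j: "\<And>z. z \<in> F \<Longrightarrow> cuts \<rho> (j z)"
      "\<And>z. z \<in> F \<Longrightarrow> ?C (x, i) (z, j z)" "\<And>z. z \<in> F \<Longrightarrow> ?C (x, i + 2) (z, j z + 2)"
    by metis
  have T1: "?T (x, i) (z, j z)" if "z \<in> F" for z
  proof (rule parallel_outer_linked[OF F(1) x i])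
    show "region_linked (\<lambda>_. \<rho>) {} (x, i) (z, j z)"
      using parallel_same_side[OF xX _ i j(1)[OF that] j(2,3)[OF that]] that F by auto
  qed (use that j in auto)
  have T2: "?T (x, i + 2) (z, j z + 2)" if "z \<in> F" for z
  proof (rule parallel_outer_linked[OF F(1) x])
    show "cuts \<rho> (i + 2)" using i by simp
    show "\<exists>j. cuts \<rho> j \<and> ?C (x, i + 2) (z, j) \<and> ?C (x, i + 2 + 2) (z, j + 2)" if "z \<in> F" for z
      using j[OF that] by (intro exI[of _ "j z + 2"]) simp
    show "region_linked (\<lambda>_. \<rho>) {} (x, i + 2) (z, j z + 2)"
      using parallel_same_side[of x z \<rho> "i + 2" "j z + 2"] j[OF that] i xX that F by auto
  qed (use that j in auto)
  have "components S (region_rel (flip \<rho> F) {}) =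
      components S (insert ((x, i), (x, i + 2)) (region_rel (\<lambda>_. \<rho>) F))" (is "_ = components S ?r")
  proof (rule components_cong')
    fix u v assume uv: "(u, v) \<in> region_rel (flip \<rho> F) {}" "u \<in> S" "v \<in> S"
    show "linked S ?r u v"
    proof (cases "(u, v) \<in> region_rel (\<lambda>_. \<rho>) F")
      case False
      then obtain z k where z: "z \<in> F" "u = (z, k)" "v = (z, k + 2)" "cuts \<rho> k"
        using uv F unfolding region_rel_def flip_def by (auto split: if_splits)
      have k: "k = j z \<or> k = j z + 2"
        using z(4) j(1)[OF z(1)] four_cases_from[of k "j z"] by auto
      have l: "linked S ?r (x, i) (z, j z)" "linked S ?r (x, i + 2) (z, j z + 2)"
        using T1[OF z(1)] T2[OF z(1)] linked_mono[of "region_rel (\<lambda>_. \<rho>) F" ?r] by blast+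
      have "linked S ?r (x, i) (x, i + 2)" using xX by (intro linked_step) auto
      then have "linked S ?r (z, j z) (z, j z + 2)"
        using linked_trans[OF linked_sym[OF l(1)] linked_trans[OF _ l(2)]] by blast
      then show ?thesis using k z linked_sym[of S ?r "(z, j z)" "(z, j z + 2)"] by auto
    qed (use uv in \<open>auto intro: linked_step\<close>)
  next
    fix u v assume uv: "(u, v) \<in> ?r" "u \<in> S" "v \<in> S"
    have "(u, v) \<in> region_rel (flip \<rho> F) {}"
      using uv x xX i unfolding region_rel_def flip_def by auto
    then show "linked S (region_rel (flip \<rho> F) {}) u v" using uv by (intro linked_step)
  qed
  then have "faces (\<lambda>_. \<rho>) F \<le> Suc (faces (flip \<rho> F) {})"
    using ncomp_insert_le(2)[of S "region_rel (\<lambda>_. \<rho>) F" "(x, i)" "(x, i + 2)"] by (simp add: ncomp_def)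
  moreover have "components S (curve_rel (\<lambda>_. \<rho>) F) = components S (curve_rel (\<lambda>_. \<rho>) {x})"
  proof (rule components_cong')
    fix u v assume uv: "(u, v) \<in> curve_rel (\<lambda>_. \<rho>) F" "u \<in> S" "v \<in> S"
    show "curve_linked (\<lambda>_. \<rho>) {x} u v"
    proof (cases "(u, v) \<in> curve_rel (\<lambda>_. \<rho>) {x}")
      case False
      then obtain z k where z: "z \<in> F" "u = (z, k)" "v = (z, k + 2)"
        using uv unfolding curve_rel_def by blast
      have m: "curve_linked (\<lambda>_. \<rho>) {x} a b" if "?C a b" for a b
        using that by (rule linked_mono[rotated]) (auto simp: curve_rel_def)
      have "curve_linked (\<lambda>_. \<rho>) {x} (z, j z) (z, j z + 2)"
        using linked_trans[OF linked_sym[OF m[OF j(2)[OF z(1)]]]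
            linked_trans[OF linked_at_unresolved[OF xX] m[OF j(3)[OF z(1)]]]] by simp
      then have "curve_linked (\<lambda>_. \<rho>) {x} (z, k) (z, k + 2)"
        by (rule linked_at_crossing[where \<rho> = \<rho>, rotated])
           (use z F curve_linked_reconnect[of z "\<lambda>_. \<rho>" "{x}"] in auto)
      then show ?thesis using z by simp
    qed (use uv in \<open>auto intro: linked_step\<close>)
  next
    fix u v assume uv: "(u, v) \<in> curve_rel (\<lambda>_. \<rho>) {x}" "u \<in> S" "v \<in> S"
    then show "curve_linked (\<lambda>_. \<rho>) F u v" using x unfolding curve_rel_def by (intro linked_step) auto
  qed
  then have "curves (\<lambda>_. \<rho>) {} \<le> Suc (curves (\<lambda>_. \<rho>) F)"
    using curves_insert(2)[OF xX, of "\<lambda>_. \<rho>" "{}"] by (simp add: ncomp_def)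
  ultimately show "curves (\<lambda>_. \<rho>) {} + card F \<le> curves (flip \<rho> F) {} + 2"
    using euler[of F "\<lambda>_. \<rho>"] euler[of "{}" "flip \<rho> F"] F by simp
qed (rule curves_flip_le[OF F])

end

section \<open>Extreme coefficients of the Kauffman bracket\<close>

definition loop_value :: "int fls" where
  "loop_value = - fls_X_intpow 2 - fls_X_intpow (- 2)"

lemma loop_value_power_Suc_nth:
  "fls_nth (loop_value ^ Suc k) n = - fls_nth (loop_value ^ k) (n - 2) - fls_nth (loop_value ^ k) (n + 2)"
proof -
  have "loop_value * g = - (fls_X_intpow 2 * g) - fls_X_intpow (- 2) * g" for g
    unfolding loop_value_def by (simp add: left_diff_distrib)
  then have "loop_value ^ Suc k = - fls_shift (- 2) (loop_value ^ k) - fls_shift (- (- 2)) (loop_value ^ k)"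
    unfolding power_Suc fls_X_intpow_times_conv_shift by blast
  then show ?thesis by simp
qed

text \<open>
  The terms of the bracket of highest degree come from the states near the all-\<open>A\<close> state, those of
  lowest degree from the states near the all-\<open>B\<close> state. The factor \<open>sign \<rho>\<close> turns the latter into
  the former, since \<open>loop_value\<close> is symmetric under inversion of the variable.
\<close>

definition sign :: "resolution \<Rightarrow> int" where
  "sign \<rho> = (case \<rho> of ResA \<Rightarrow> 1 | ResB \<Rightarrow> - 1)"

lemma sign_simps [simp]: "sign ResA = 1" "sign ResB = - 1" "sign (opposite \<rho>) = - sign \<rho>"
  "sign \<rho> * sign \<rho> = 1" "sign \<rho> * (sign \<rho> * a) = a"
  by (cases \<rho>; simp add: sign_def)+

lemma loop_value_power_nth:
  shows "sign \<rho> * n > 2 * int k \<Longrightarrow> fls_nth (loop_value ^ k) n = 0"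
    and "fls_nth (loop_value ^ k) (sign \<rho> * (2 * int k)) = (- 1) ^ k"
    and "fls_nth (loop_value ^ k) (sign \<rho> * (2 * int k - 4)) = (- 1) ^ k * int k"
proof -
  have above: "\<forall>n. sign \<rho> * n > 2 * int k \<longrightarrow> fls_nth (loop_value ^ k) n = 0" for k
  proof (induction k)
    case (Suc k)
    then show ?case by (cases \<rho>) (auto simp: loop_value_power_Suc_nth simp del: power_Suc)
  qed (cases \<rho>; simp)
  then show "sign \<rho> * n > 2 * int k \<Longrightarrow> fls_nth (loop_value ^ k) n = 0" by blast
  have top: "fls_nth (loop_value ^ k) (sign \<rho> * (2 * int k)) = (- 1) ^ k" for k
  proof (induction k)
    case (Suc k)
    then show ?case using above[of k]
      by (cases \<rho>) (simp_all add: loop_value_power_Suc_nth algebra_simps del: power_Suc, simp_all)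
  qed simp
  then show "fls_nth (loop_value ^ k) (sign \<rho> * (2 * int k)) = (- 1) ^ k" .
  show "fls_nth (loop_value ^ k) (sign \<rho> * (2 * int k - 4)) = (- 1) ^ k * int k"
  proof (induction k)
    case (Suc k)
    then show ?case using top[of k]
      by (cases \<rho>) (simp_all add: loop_value_power_Suc_nth algebra_simps del: power_Suc, simp_all)
  qed (cases \<rho>; simp)
qed

lemma sum_Pow_minus_one:
  assumes "finite P" "P \<noteq> {}" shows "(\<Sum>F\<in>Pow P. (- 1) ^ card F) = (0::int)"
proof -
  obtain x where x: "x \<in> P" using assms(2) by auto
  define A where "A = P - {x}"
  have A: "P = insert x A" "x \<notin> A" "finite A" using x assms(1) by (auto simp: A_def)
  have inj: "inj_on (insert x) (Pow A)" using A(2) by (auto simp: inj_on_def)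
  have "(\<Sum>F\<in>insert x ` Pow A. (- 1) ^ card F) = (\<Sum>F\<in>Pow A. (- 1) ^ card (insert x F) :: int)"
    by (simp add: sum.reindex[OF inj])
  also have "\<dots> = (\<Sum>F\<in>Pow A. - ((- 1) ^ card F))"
  proof (rule sum.cong)
    fix F assume "F \<in> Pow A"
    then have "x \<notin> F" "finite F" using A finite_subset by auto
    then show "(- 1) ^ card (insert x F) = - ((- 1) ^ card F :: int)" by simp
  qed simp
  also have "\<dots> = - (\<Sum>F\<in>Pow A. (- 1) ^ card F)" by (simp add: sum_negf)
  finally have "(\<Sum>F\<in>insert x ` Pow A. (- 1) ^ card F) = - (\<Sum>F\<in>Pow A. (- 1) ^ card F :: int)" .
  moreover have "(\<Sum>F\<in>Pow P. (- 1) ^ card F) =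
      (\<Sum>F\<in>Pow A. (- 1) ^ card F) + (\<Sum>F\<in>insert x ` Pow A. (- 1) ^ card F :: int)"
    unfolding A(1) Pow_insert using A(2,3) by (intro sum.union_disjoint) auto
  ultimately show ?thesis by simp
qed

context adequate_diagram
begin

lemma curves_pos: "curves \<sigma> {} > 0"
proof -
  obtain x where "x \<in> X" using X_nonempty by auto
  then have "{e. curve_linked \<sigma> {} (x, 0) e} \<in> components S (curve_rel \<sigma> {})"
    by (intro component_of_in) simp
  then show ?thesis using finite_components[OF finite_S] by (auto simp: ncomp_def card_gt_0_iff)
qed

lemma bracket_nth:
  "fls_nth (kauffman_bracket D) n =
    (\<Sum>F\<in>Pow X. fls_nth (loop_value ^ (curves (flip \<rho> F) {} - 1))
      (n - sign \<rho> * (int (card X) - 2 * int (card F))))"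
proof -
  let ?h = "\<lambda>F. restrict (flip \<rho> F) X"
  have bij: "bij_betw ?h (Pow X) (X \<rightarrow>\<^sub>E UNIV)"
  proof (rule bij_betw_byWitness[where f' = "\<lambda>\<sigma>. {x \<in> X. \<sigma> x \<noteq> \<rho>}"])
    show "\<forall>\<sigma>\<in>X \<rightarrow>\<^sub>E UNIV. ?h {x \<in> X. \<sigma> x \<noteq> \<rho>} = \<sigma>"
    proof
      fix \<sigma> :: "'a \<Rightarrow> resolution" assume \<sigma>: "\<sigma> \<in> X \<rightarrow>\<^sub>E UNIV"
      show "?h {x \<in> X. \<sigma> x \<noteq> \<rho>} = \<sigma>"
      proof
        fix x
        consider "x \<notin> X" | "x \<in> X" "\<sigma> x = \<rho>" | "x \<in> X" "\<sigma> x = opposite \<rho>"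
          using resolution_cases by blast
        then show "?h {x \<in> X. \<sigma> x \<noteq> \<rho>} x = \<sigma> x"
          by cases (simp_all add: flip_def PiE_arb[OF \<sigma>])
      qed
    qed
  qed (auto simp: flip_def)
  have exponent: "(\<Sum>x\<in>X. case ?h F x of ResA \<Rightarrow> 1 | ResB \<Rightarrow> - 1) =
      sign \<rho> * (int (card X) - 2 * int (card F))" if "F \<subseteq> X" for F
  proof -
    have "(\<Sum>x\<in>X. case ?h F x of ResA \<Rightarrow> 1 | ResB \<Rightarrow> - 1) = (\<Sum>x\<in>X. sign (flip \<rho> F x))"
      by (simp add: sign_def)
    also have "\<dots> = (\<Sum>x\<in>X. if x \<in> F then - sign \<rho> else sign \<rho>)"
      by (intro sum.cong) (auto simp: flip_def)
    also have "\<dots> = (\<Sum>x\<in>F. - sign \<rho>) + (\<Sum>x\<in>X - F. sign \<rho>)"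
      using that by (simp add: sum.If_cases Int_absorb1 Diff_eq Int_def[symmetric] Compl_eq)
    also have "\<dots> = sign \<rho> * (int (card X) - 2 * int (card F))"
      using that finite_subset[OF that] card_mono[OF finite_X that]
      by (simp add: card_Diff_subset algebra_simps of_nat_diff)
    finally show ?thesis .
  qed
  have circles: "card (circles D (?h F)) = curves (flip \<rho> F) {}" for F
    unfolding card_circles by (rule curves_cong) simp
  have "kauffman_bracket D = (\<Sum>F\<in>Pow X. fls_X_intpow (\<Sum>x\<in>X. case ?h F x of ResA \<Rightarrow> 1 | ResB \<Rightarrow> - 1) *
      loop_value ^ (card (circles D (?h F)) - 1))"
    unfolding kauffman_bracket_def loop_value_def[symmetric] by (rule sum.reindex_bij_betw[OF bij, symmetric])
  also have "\<dots> = (\<Sum>F\<in>Pow X. fls_X_intpow (sign \<rho> * (int (card X) - 2 * int (card F))) *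
      loop_value ^ (curves (flip \<rho> F) {} - 1))"
    using exponent by (intro sum.cong) (auto simp: circles)
  finally show ?thesis
    by (simp add: fls_nth_sum fls_X_intpow_times_conv_shift)
qed

text \<open>The highest degree in the all-\<open>A\<close> term, and minus the lowest degree in the all-\<open>B\<close> term.\<close>

definition extent :: "resolution \<Rightarrow> int" where
  "extent \<rho> = int (card X) + 2 * (int (curves (\<lambda>_. \<rho>) {}) - 1)"

lemma bracket_nth_above:
  assumes "sign \<rho> * n > extent \<rho>" shows "fls_nth (kauffman_bracket D) n = 0"
  unfolding bracket_nth[of n \<rho>]
proof (rule sum.neutral, rule ballI)
  fix F assume "F \<in> Pow X"
  then have "curves (flip \<rho> F) {} \<le> curves (\<lambda>_. \<rho>) {} + card F"
    using curves_flip_mono[of "{}" F \<rho>] by simp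
  then show "fls_nth (loop_value ^ (curves (flip \<rho> F) {} - 1))
      (n - sign \<rho> * (int (card X) - 2 * int (card F))) = 0"
    using assms curves_pos[of "flip \<rho> F"]
    by (intro loop_value_power_nth(1)[of _ \<rho>]) (simp add: extent_def right_diff_distrib of_nat_diff)
qed

lemma bracket_nth_top:
  "fls_nth (kauffman_bracket D) (sign \<rho> * extent \<rho>) = (- 1) ^ (curves (\<lambda>_. \<rho>) {} - 1)"
proof -
  let ?t = "\<lambda>F. fls_nth (loop_value ^ (curves (flip \<rho> F) {} - 1))
      (sign \<rho> * extent \<rho> - sign \<rho> * (int (card X) - 2 * int (card F)))"
  have "?t F = 0" if "F \<in> Pow X - {{}}" for F
    using that curves_flip_le[of F \<rho>] curves_pos[of "flip \<rho> F"]
    by (intro loop_value_power_nth(1)[of _ \<rho>]) (simp add: extent_def right_diff_distrib of_nat_diff)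
  then have "(\<Sum>F\<in>Pow X. ?t F) = (\<Sum>F\<in>{{}}. ?t F)"
    by (intro sum.mono_neutral_right) auto
  also have "\<dots> = (- 1) ^ (curves (\<lambda>_. \<rho>) {} - 1)"
    using loop_value_power_nth(2)[of "curves (\<lambda>_. \<rho>) {} - 1" \<rho>] curves_pos[of "\<lambda>_. \<rho>"]
    by (simp add: extent_def of_nat_diff algebra_simps)
  finally show ?thesis by (simp only: bracket_nth[of _ \<rho>])
qed

text \<open>
  Besides the constant state, only those states contribute that flip parallel edges of the state
  graph; the contributions of the nonempty subsets of a parallel class add up to that of one edge.
\<close>

lemma bracket_nth_next:
  "fls_nth (kauffman_bracket D) (sign \<rho> * (extent \<rho> - 4)) =
    (- 1) ^ (curves (\<lambda>_. \<rho>) {} - 1) * (int (curves (\<lambda>_. \<rho>) {}) - 1 - int (card (ends_at \<rho> ` X)))"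
proof -
  let ?v = "curves (\<lambda>_. \<rho>) {}"
  let ?t = "\<lambda>F. fls_nth (loop_value ^ (curves (flip \<rho> F) {} - 1))
      (sign \<rho> * (extent \<rho> - 4) - sign \<rho> * (int (card X) - 2 * int (card F)))"
  define P where "P E = {x \<in> X. ends_at \<rho> x = E}" for E
  define \<F> where "\<F> E = Pow (P E) - {{}}" for E
  have zero: "?t F = 0" if F: "F \<in> Pow X - {{}}" "F \<notin> (\<Union>E\<in>ends_at \<rho> ` X. \<F> E)" for F
  proof -
    obtain x where x: "x \<in> F" using F by auto
    then obtain y where y: "y \<in> F" "ends_at \<rho> y \<noteq> ends_at \<rho> x"
      using F unfolding \<F>_def P_def by blast
    have "curves (flip \<rho> F) {} + 4 \<le> ?v + card F"
      using curves_flip_le_nonparallel[OF _ y(1) x y(2)] F by auto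
    then show ?thesis
      using curves_pos[of "flip \<rho> F"]
      by (intro loop_value_power_nth(1)[of _ \<rho>]) (simp add: extent_def right_diff_distrib of_nat_diff)
  qed
  have parallel: "?t F = (- 1) ^ (?v - 1) * (- 1) ^ card F" if "F \<in> \<F> E" for F E
  proof -
    have c: "curves (flip \<rho> F) {} + 2 = ?v + card F"
      using that by (intro curves_flip_parallel) (auto simp: \<F>_def P_def)
    have "extent \<rho> - 4 - (int (card X) - 2 * int (card F)) = 2 * int (curves (flip \<rho> F) {} - 1)"
      using c curves_pos[of "flip \<rho> F"] by (simp add: extent_def of_nat_diff)
    then have "?t F = (- 1) ^ (curves (flip \<rho> F) {} - 1)"
      using loop_value_power_nth(2)[of "curves (flip \<rho> F) {} - 1" \<rho>]
      by (simp only: right_diff_distrib[symmetric])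
    also have "\<dots> = (- 1) ^ (curves (flip \<rho> F) {} - 1 + 2)" by simp
    also have "curves (flip \<rho> F) {} - 1 + 2 = ?v - 1 + card F"
      using c curves_pos[of "flip \<rho> F"] curves_pos[of "\<lambda>_. \<rho>"] by simp
    finally show ?thesis by (simp add: power_add)
  qed
  have finP: "finite (P E)" for E by (simp add: P_def)
  have "(\<Sum>F\<in>Pow X - {{}}. ?t F) = (\<Sum>F\<in>(\<Union>E\<in>ends_at \<rho> ` X. \<F> E). ?t F)"
  proof (rule sum.mono_neutral_right)
    show "(\<Union>E\<in>ends_at \<rho> ` X. \<F> E) \<subseteq> Pow X - {{}}" by (auto simp: \<F>_def P_def)
    show "\<forall>F\<in>Pow X - {{}} - (\<Union>E\<in>ends_at \<rho> ` X. \<F> E). ?t F = 0" using zero by blast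
  qed simp
  also have "\<dots> = (\<Sum>E\<in>ends_at \<rho> ` X. \<Sum>F\<in>\<F> E. ?t F)"
  proof (rule sum.UNION_disjoint)
    show "\<forall>E\<in>ends_at \<rho> ` X. \<forall>E'\<in>ends_at \<rho> ` X. E \<noteq> E' \<longrightarrow> \<F> E \<inter> \<F> E' = {}"
      unfolding \<F>_def P_def by blast
  qed (auto simp: \<F>_def finP)
  also have "\<dots> = (\<Sum>E\<in>ends_at \<rho> ` X. - ((- 1) ^ (?v - 1)))"
  proof (rule sum.cong)
    fix E assume E: "E \<in> ends_at \<rho> ` X"
    have "(\<Sum>F\<in>Pow (P E). (- 1) ^ card F) = (0::int)"
      by (rule sum_Pow_minus_one) (use E finP in \<open>auto simp: P_def\<close>)
    then have "(\<Sum>F\<in>\<F> E. (- 1) ^ card F) = (- 1 :: int)"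
      unfolding \<F>_def by (subst sum_diff1) (auto simp: finP)
    moreover have "(\<Sum>F\<in>\<F> E. ?t F) = (\<Sum>F\<in>\<F> E. (- 1) ^ (?v - 1) * (- 1) ^ card F)"
      by (rule sum.cong) (use parallel in auto)
    ultimately show "(\<Sum>F\<in>\<F> E. ?t F) = - ((- 1) ^ (?v - 1))"
      by (simp add: sum_distrib_left[symmetric])
  qed simp
  finally have "(\<Sum>F\<in>Pow X - {{}}. ?t F) = - ((- 1) ^ (?v - 1) * int (card (ends_at \<rho> ` X)))"
    by simp
  moreover have "?t {} = (- 1) ^ (?v - 1) * (int ?v - 1)"
    using loop_value_power_nth(3)[of "?v - 1" \<rho>] curves_pos[of "\<lambda>_. \<rho>"]
    by (simp add: extent_def of_nat_diff algebra_simps)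
  moreover have "(\<Sum>F\<in>Pow X. ?t F) = ?t {} + (\<Sum>F\<in>Pow X - {{}}. ?t F)"
    by (rule sum.remove) auto
  ultimately show ?thesis
    unfolding bracket_nth[of "sign \<rho> * (extent \<rho> - 4)" \<rho>] by (simp add: algebra_simps)
qed

text \<open>
  Putting the crossings in \<open>W\<close> back merges circles, and it suffices to put back one crossing of each
  class of parallel edges. For \<open>W = X\<close>, this says that the reduced state graph has at least the edges
  of a spanning tree.
\<close>

lemma curves_le_reduced_edges:
  assumes "W \<subseteq> X"
  shows "curves (\<lambda>_. \<rho>) {} \<le> curves (\<lambda>_. \<rho>) W + card (ends_at \<rho> ` W)"
proof -
  have finW: "finite W" using assms finite_X by (rule finite_subset)
  define p where "p E = (SOME x. x \<in> W \<and> ends_at \<rho> x = E)" for E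
  define Y where "Y = (\<lambda>E. ((p E, 0 :: 4), (p E, 2 :: 4))) ` ends_at \<rho> ` W"
  let ?r = "curve_rel (\<lambda>_. \<rho>) {} \<union> Y"
  have p: "p (ends_at \<rho> z) \<in> W \<and> ends_at \<rho> (p (ends_at \<rho> z)) = ends_at \<rho> z" if "z \<in> W" for z
    unfolding p_def by (rule someI[of _ z]) (use that in simp)
  have "components S (curve_rel (\<lambda>_. \<rho>) W) = components S ?r"
  proof (rule components_cong')
    fix u v assume uv: "(u, v) \<in> curve_rel (\<lambda>_. \<rho>) W" "u \<in> S" "v \<in> S"
    show "linked S ?r u v"
    proof (cases "(u, v) \<in> curve_rel (\<lambda>_. \<rho>) {}")
      case False
      then obtain z k where z: "z \<in> W" "u = (z, k)" "v = (z, k + 2)"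
        using uv unfolding curve_rel_def by blast
      define x where "x = p (ends_at \<rho> z)"
      have x: "x \<in> W" "ends_at \<rho> x = ends_at \<rho> z" using p[OF z(1)] by (auto simp: x_def)
      have m: "linked S ?r a b" if "curve_linked (\<lambda>_. \<rho>) {} a b" for a b
        using that by (rule linked_mono[rotated]) auto
      have x02: "linked S ?r (x, 0) (x, 2)"
        using x(1) z(1) assms by (intro linked_step) (auto simp: Y_def x_def)
      have "curve_linked (\<lambda>_. \<rho>) {} (x, 0) (z, 0) \<and> curve_linked (\<lambda>_. \<rho>) {} (x, 2) (z, 2) \<or>
          curve_linked (\<lambda>_. \<rho>) {} (x, 0) (z, 2) \<and> curve_linked (\<lambda>_. \<rho>) {} (x, 2) (z, 0)"
        using x(2) unfolding ends_at_def doubleton_eq_iff circ_eq_iff .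
      then have "linked S ?r (z, 0) (z, 2)"
      proof (elim disjE conjE)
        assume a: "curve_linked (\<lambda>_. \<rho>) {} (x, 0) (z, 0)" "curve_linked (\<lambda>_. \<rho>) {} (x, 2) (z, 2)"
        show ?thesis using linked_trans[OF linked_sym[OF m[OF a(1)]] linked_trans[OF x02 m[OF a(2)]]] .
      next
        assume a: "curve_linked (\<lambda>_. \<rho>) {} (x, 0) (z, 2)" "curve_linked (\<lambda>_. \<rho>) {} (x, 2) (z, 0)"
        show ?thesis
          using linked_trans[OF linked_sym[OF m[OF a(2)]] linked_trans[OF linked_sym[OF x02] m[OF a(1)]]] .
      qed
      then have "linked S ?r (z, 0) (z, 0 + 2)" by simp
      then have "linked S ?r (z, k) (z, k + 2)"
        by (rule linked_at_crossing[where \<rho> = \<rho>, rotated])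
           (use z assms curve_linked_reconnect[of z "\<lambda>_. \<rho>" "{}"] m in auto)
      then show ?thesis using z by simp
    qed (use uv in \<open>auto intro: linked_step\<close>)
  next
    fix u v assume uv: "(u, v) \<in> ?r" "u \<in> S" "v \<in> S"
    have "Y \<subseteq> {((x, i), (x, i + 2)) | x i. x \<in> W}"
      using p by (fastforce simp: Y_def)
    then have "(u, v) \<in> curve_rel (\<lambda>_. \<rho>) W" using uv(1) unfolding curve_rel_def by blast
    then show "curve_linked (\<lambda>_. \<rho>) W u v" using uv by (intro linked_step)
  qed
  then have "curves (\<lambda>_. \<rho>) W = ncomp S ?r" by (simp add: ncomp_def)
  moreover have "curves (\<lambda>_. \<rho>) {} \<le> ncomp S ?r + card Y"
    by (rule ncomp_Un_le) (use finW in \<open>auto simp: Y_def\<close>)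
  moreover have "card Y \<le> card (ends_at \<rho> ` W)" using finW by (simp add: Y_def card_image_le)
  ultimately show ?thesis by simp
qed

section \<open>The second and next-to-last coefficients of the Jones polynomial\<close>

text \<open>The first Betti number of the reduced state graph, which is connected.\<close>

definition betti :: "resolution \<Rightarrow> int" where
  "betti \<rho> = int (card (ends_at \<rho> ` X)) - int (curves (\<lambda>_. \<rho>) {}) + 1"

lemma betti_nonneg: "betti \<rho> \<ge> 0"
  using curves_le_reduced_edges[of X \<rho>] curves_all by (simp add: betti_def)

lemma abs_bracket_nth_next: "\<bar>fls_nth (kauffman_bracket D) (sign \<rho> * (extent \<rho> - 4))\<bar> = betti \<rho>"
proof -
  have "int (curves (\<lambda>_. \<rho>) {}) - 1 - int (card (ends_at \<rho> ` X)) = - betti \<rho>" by (simp add: betti_def)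
  then show ?thesis using betti_nonneg[of \<rho>] by (simp add: bracket_nth_next abs_mult power_abs)
qed

lemma jones_coeff_eq:
  "jones_coeff D (of_int k / 4) = (- 1) ^ nat \<bar>writhe D\<bar> * fls_nth (kauffman_bracket D) (3 * writhe D - k)"
proof -
  have "normalized_bracket D =
      (- 1) ^ nat \<bar>writhe D\<bar> * fls_shift (- (- 3 * writhe D)) (kauffman_bracket D)"
    unfolding normalized_bracket_def mult.assoc fls_X_intpow_times_conv_shift(1) ..
  then have "fls_nth (normalized_bracket D) n =
      (- 1) ^ nat \<bar>writhe D\<bar> * fls_nth (kauffman_bracket D) (n + 3 * writhe D)" for n
    by (cases "even (nat \<bar>writhe D\<bar>)") simp_all
  then show ?thesis by (simp add: jones_coeff_def algebra_simps)
qed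

lemma jones_support:
  assumes "jones_coeff D r \<noteq> 0"
  obtains k where "r = of_int k / 4" "3 * writhe D - extent ResA \<le> k" "k \<le> 3 * writhe D + extent ResB"
proof -
  from assms have "4 * r \<in> \<int>" by (auto simp: jones_coeff_def split: if_splits)
  then obtain k where k: "4 * r = of_int k" by (auto elim: Ints_cases)
  then have r: "r = of_int k / 4" by simp
  then have nz: "fls_nth (kauffman_bracket D) (3 * writhe D - k) \<noteq> 0"
    using assms unfolding r jones_coeff_eq by auto
  have "3 * writhe D - extent ResA \<le> k"
    using bracket_nth_above[of ResA "3 * writhe D - k"] nz by force
  moreover have "k \<le> 3 * writhe D + extent ResB"
    using bracket_nth_above[of ResB "3 * writhe D - k"] nz by force
  ultimately show thesis using that r by blast
qed

lemma finite_jones_support: "finite {r. jones_coeff D r \<noteq> 0}"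
proof (rule finite_subset)
  show "{r. jones_coeff D r \<noteq> 0} \<subseteq>
      (\<lambda>k. of_int k / 4) ` {3 * writhe D - extent ResA..3 * writhe D + extent ResB}"
    by (auto elim!: jones_support)
qed simp

lemma jones_min_exp_eq: "jones_min_exp D = of_int (3 * writhe D - extent ResA) / 4"
  unfolding jones_min_exp_def
proof (rule Min_eqI[OF finite_jones_support])
  show "of_int (3 * writhe D - extent ResA) / 4 \<le> r" if r: "r \<in> {r. jones_coeff D r \<noteq> 0}" for r
  proof -
    obtain k where "r = of_int k / 4" "3 * writhe D - extent ResA \<le> k"
      using jones_support[of r] r by blast
    then show ?thesis by (metis divide_right_mono of_int_le_iff zero_le_numeral)
  qed
  show "of_int (3 * writhe D - extent ResA) / 4 \<in> {r. jones_coeff D r \<noteq> 0}"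
    using bracket_nth_top[of ResA] by (simp add: jones_coeff_eq del: of_int_diff)
qed

lemma jones_max_exp_eq: "jones_max_exp D = of_int (3 * writhe D + extent ResB) / 4"
  unfolding jones_max_exp_def
proof (rule Max_eqI[OF finite_jones_support])
  show "r \<le> of_int (3 * writhe D + extent ResB) / 4" if r: "r \<in> {r. jones_coeff D r \<noteq> 0}" for r
  proof -
    obtain k where "r = of_int k / 4" "k \<le> 3 * writhe D + extent ResB"
      using jones_support[of r] r by blast
    then show ?thesis by (metis divide_right_mono of_int_le_iff zero_le_numeral)
  qed
  show "of_int (3 * writhe D + extent ResB) / 4 \<in> {r. jones_coeff D r \<noteq> 0}"
    using bracket_nth_top[of ResB] by (simp add: jones_coeff_eq del: of_int_add)
qed

lemma abs_jones_next_to_last_coeff: "\<bar>jones_next_to_last_coeff D\<bar> = betti ResA"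
proof -
  have "jones_min_exp D + 1 = of_int (3 * writhe D - extent ResA + 4) / 4"
    by (simp add: jones_min_exp_eq add_divide_distrib)
  then show ?thesis
    using abs_bracket_nth_next[of ResA]
    unfolding jones_next_to_last_coeff_def by (simp only: jones_coeff_eq) (simp add: abs_mult power_abs)
qed

lemma abs_jones_second_coeff: "\<bar>jones_second_coeff D\<bar> = betti ResB"
proof -
  have "jones_max_exp D - 1 = of_int (3 * writhe D + extent ResB - 4) / 4"
    by (simp add: jones_max_exp_eq diff_divide_distrib)
  then show ?thesis
    using abs_bracket_nth_next[of ResB]
    unfolding jones_second_coeff_def by (simp only: jones_coeff_eq) (simp add: abs_mult power_abs)
qed

end

section \<open>Bigons and twist regions\<close>

locale twisted_diagram = adequate_diagram +
  assumes alternating: "alternating_in_twist_regions D"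
    and three_crossings: "T \<in> twist_regions D \<Longrightarrow> card T \<ge> 3"
begin

lemma next_side_inj: "d \<in> S \<Longrightarrow> e \<in> S \<Longrightarrow> next_side D d = next_side D e \<Longrightarrow> d = e"
  using join_eq_iff[of d e] by (auto simp: next_side_eq rot_def prod_eq_iff)

definition side_rel :: "('a dart \<times> 'a dart) set" where
  "side_rel = {(d, next_side D d) | d. d \<in> S}"

lemma side_rel_iff: "(u, v) \<in> side_rel \<longleftrightarrow> u \<in> S \<and> v = next_side D u"
  unfolding side_rel_def by blast

lemma regions_eq: "regions D = components S side_rel"
  by (simp only: regions_def side_rel_def)

lemma bigon_subset: "R \<in> bigons D \<Longrightarrow> R \<subseteq> S"
  using component_subset by (auto simp: bigons_def regions_eq)

lemma bigons_disjoint: "R \<in> bigons D \<Longrightarrow> R' \<in> bigons D \<Longrightarrow> d \<in> R \<Longrightarrow> d \<in> R' \<Longrightarrow> R = R'"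
  unfolding bigons_def regions_eq using components_disjoint[of R S side_rel R' d] by blast

lemma finite_bigons: "finite (bigons D)"
  using finite_components[OF finite_S, of side_rel] by (simp add: bigons_def regions_eq)

lemma bigon_next_side:
  assumes R: "R \<in> bigons D" and d: "d \<in> R"
  shows "R = {d, next_side D d}" "next_side D d \<noteq> d" "next_side D (next_side D d) = d"
proof -
  have dS: "d \<in> S" using bigon_subset[OF R] d by auto
  have R': "R \<in> components S side_rel" and c: "card R = 2"
    using R by (auto simp: bigons_def regions_eq)
  have closed: "next_side D e \<in> R" if "e \<in> R" for e
    using component_closed[OF R' that linked_step] bigon_subset[OF R] that
    by (meson next_side_in side_rel_iff subsetD)
  show ne: "next_side D d \<noteq> d"
  proof
    assume fix_d: "next_side D d = d"
    have "R \<subseteq> {d}"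
    proof
      fix e assume "e \<in> R"
      then have "linked S side_rel d e" using in_component[OF R' d] by auto
      then show "e \<in> {d}"
      proof (rule linked_closed)
        fix u v assume "(u, v) \<in> side_rel" "u \<in> S"
        then show "u \<in> {d} \<longleftrightarrow> v \<in> {d}"
          using fix_d next_side_inj[of u d] dS by (auto simp: side_rel_iff)
      qed simp
    qed
    then show False using c card_mono[of "{d}" R] by simp
  qed
  show eq: "R = {d, next_side D d}"
    using c d closed[OF d] ne by (auto simp: card_2_iff)
  have "next_side D (next_side D d) \<noteq> next_side D d"
    using next_side_inj[of "next_side D d" d] ne dS by auto
  then show "next_side D (next_side D d) = d"
    using closed[OF closed[OF d]] eq by auto
qed

text \<open>The two crossings of a bigon are different, since the diagram would not be adequate otherwise.\<close>

lemma bigon_at: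
  assumes R: "R \<in> bigons D" and x: "(x, i) \<in> R"
  obtains y j where "R = {(x, i), (y, j)}" "x \<in> X" "y \<in> X" "x \<noteq> y"
    "join D (x, i) = (y, j + 1)" "join D (y, j) = (x, i + 1)"
    "join D (x, i + 1) = (y, j)" "join D (y, j + 1) = (x, i)"
proof -
  obtain y j where yj: "next_side D (x, i) = (y, j)" by fastforce
  have xX: "x \<in> X" using bigon_subset[OF R] x by auto
  have R': "R = {(x, i), (y, j)}" "(y, j) \<noteq> (x, i)" "next_side D (y, j) = (x, i)"
    using bigon_next_side[OF R x] yj by auto
  then have yX: "y \<in> X" using bigon_subset[OF R] by auto
  have 1: "join D (x, i) = (y, j + 1)" "join D (y, j) = (x, i + 1)"
    using yj R'(3) by (auto simp: next_side_def split: prod.splits)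
  have 2: "join D (x, i + 1) = (y, j)" "join D (y, j + 1) = (x, i)"
    using join_join[of "(y, j)"] join_join[of "(x, i)"] 1 xX yX by simp_all
  have "x \<noteq> y"
  proof
    assume xy: "x = y"
    have "j + 1 \<noteq> i" using join_neq[of "(x, i)"] 1(1) xy xX by auto
    moreover have "j \<noteq> i + 1" using join_neq[of "(y, j)"] 1(2) xy xX by auto
    moreover have "j \<noteq> i" using R'(2) xy by auto
    ultimately have "j = i + 2" using four_cases_from[of j i] by auto
    obtain \<rho> where \<rho>: "cuts \<rho> i" using cuts_simps(4) by metis
    have "circ \<rho> (x, i) = circ \<rho> (x, i - 1)"
      using circ_join[of "(x, i)" \<rho>] 1(1) xy xX \<open>j = i + 2\<close> by simp
    also have "\<dots> = circ \<rho> (x, i + 2)"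
      using circ_reconnect[OF xX, of \<rho> "i + 2"] \<rho> by (simp add: reconnect_eq)
    finally show False using circles_separated[OF xX] circ_eq_iff by blast
  qed
  then show thesis using that R'(1) xX yX 1 2 by blast
qed

lemma bigonI:
  assumes x: "x \<in> X" and j: "join D (x, i) = (y, j + 1)" "join D (y, j) = (x, i + 1)"
    and ne: "(x, i) \<noteq> (y, j)"
  shows "{(x, i), (y, j)} \<in> bigons D"
proof -
  have y: "y \<in> X" using join_in[of "(x, i)"] j(1) x by simp
  have n: "next_side D (x, i) = (y, j)" "next_side D (y, j) = (x, i)"
    using j by (simp_all add: next_side_def)
  have "{e. linked S side_rel (x, i) e} = {(x, i), (y, j)}"
  proof (intro equalityI subsetI)
    fix e assume "e \<in> {e. linked S side_rel (x, i) e}"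
    then have "linked S side_rel (x, i) e" by simp
    then show "e \<in> {(x, i), (y, j)}"
    proof (rule linked_closed)
      fix u v assume uv: "(u, v) \<in> side_rel" "u \<in> S" "v \<in> S"
      then have v: "v = next_side D u" by (simp add: side_rel_iff)
      show "u \<in> {(x, i), (y, j)} \<longleftrightarrow> v \<in> {(x, i), (y, j)}"
        using v n next_side_inj[OF uv(2), of "(x, i)"] next_side_inj[OF uv(2), of "(y, j)"] x y by auto
    qed simp
  next
    have "linked S side_rel (x, i) (next_side D (x, i))"
      using x next_side_in[of "(x, i)"] by (intro linked_step) (auto simp: side_rel_iff)
    then show "e \<in> {e. linked S side_rel (x, i) e}" if "e \<in> {(x, i), (y, j)}" for e
      using that n by auto
  qed
  moreover have "{e. linked S side_rel (x, i) e} \<in> regions D"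
    unfolding regions_eq using x by (intro component_of_in) simp
  ultimately show ?thesis using ne by (simp add: bigons_def)
qed

lemma over_iff: "over (x, i) \<longleftrightarrow> \<not> cuts ResA i"
  using four_cases[of i] by (elim disjE; simp add: over_def cuts_iff)

lemma bigon_cuts:
  assumes "R \<in> bigons D" "(x, i) \<in> R" "(y, j) \<in> R" shows "cuts \<rho> i \<longleftrightarrow> cuts \<rho> j"
proof -
  obtain z k where R: "R = {(x, i), (z, k)}" "join D (x, i) = (z, k + 1)"
    using assms(1,2) by (rule bigon_at)
  have "over (z, k + 1) \<longleftrightarrow> \<not> over (x, i)"
    using alternating assms(1,2) R(2) unfolding alternating_in_twist_regions_def by metis
  then have "cuts ResA k \<longleftrightarrow> cuts ResA i" by (simp add: over_iff)
  then have "cuts \<rho> k \<longleftrightarrow> cuts \<rho> i"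
    using cuts_simps(4)[of ResA k] cuts_simps(4)[of ResA i] by (cases \<rho>) auto
  then show ?thesis using assms(3) R(1) by auto
qed

lemma crossing_in_bigon:
  assumes "x \<in> X" obtains R i where "R \<in> bigons D" "(x, i) \<in> R"
proof (cases "\<exists>R\<in>bigons D. x \<in> fst ` R")
  case False
  then have "{x} \<in> twist_regions D" using assms by (auto simp: twist_regions_def)
  then show thesis using three_crossings[of "{x}"] by simp
qed (use that in auto)

text \<open>Otherwise the twist region of \<open>R\<close> would have only two crossings.\<close>

lemma bigon_continues:
  assumes "R \<in> bigons D"
  obtains R' where "R' \<in> bigons D" "fst ` R' \<inter> fst ` R \<noteq> {}" "\<not> fst ` R' \<subseteq> fst ` R"
proof (rule ccontr)
  note obtain_R' = that
  assume "\<not> thesis"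
  then have closed: "fst ` R' \<subseteq> fst ` R" if "R' \<in> bigons D" "fst ` R' \<inter> fst ` R \<noteq> {}" for R'
    using that obtain_R' by blast
  let ?C = "{R'. linked (bigons D) (end_to_end D) R R'}"
  have "fst ` R' \<subseteq> fst ` R" if "linked (bigons D) (end_to_end D) R R'" for R'
    using that
  proof (induction rule: linked_induct)
    case (step R1 R2)
    then obtain z k l where "(z, k) \<in> R1" "(z, l) \<in> R2" by (auto simp: end_to_end_def)
    then have "z \<in> fst ` R1" "z \<in> fst ` R2" by force+
    then show ?case using step closed by blast
  qed simp
  then have sub: "fst ` \<Union>?C \<subseteq> fst ` R" by blast
  have "?C \<in> components (bigons D) (end_to_end D)" using assms by (rule component_of_in)
  then have "fst ` \<Union>?C \<in> twist_regions D" unfolding twist_regions_def by blast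
  then have "3 \<le> card (fst ` \<Union>?C)" by (rule three_crossings)
  also have "\<dots> \<le> card (fst ` R)"
    using sub finite_subset[OF bigon_subset[OF assms] finite_S] by (intro card_mono) auto
  also have "\<dots> \<le> card R"
    using finite_subset[OF bigon_subset[OF assms] finite_S] by (rule card_image_le)
  also have "\<dots> = 2" using assms by (simp add: bigons_def)
  finally show False by simp
qed

text \<open>
  Two bigons at adjacent corners of \<open>x\<close> have a common edge, so three edges connect their crossings \<open>x\<close>
  and \<open>y\<close>. Then every bigon at \<open>x\<close> or \<open>y\<close> has these two crossings.
\<close>

lemma no_adjacent_bigons:
  assumes "R \<in> bigons D" "(x, i) \<in> R" "R' \<in> bigons D" shows "(x, i + 1) \<notin> R'"
proof
  assume x': "(x, i + 1) \<in> R'"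
  obtain y j where R: "R = {(x, i), (y, j)}" "x \<in> X" "y \<in> X"
      "join D (x, i) = (y, j + 1)" "join D (x, i + 1) = (y, j)"
      "join D (y, j + 1) = (x, i)" "join D (y, j) = (x, i + 1)"
    using assms(1,2) by (rule bigon_at)
  obtain y' j' where R': "join D (x, i + 1) = (y', j' + 1)" "join D (x, i + 2) = (y', j')"
      "join D (y', j') = (x, i + 2)"
    using bigon_at[OF assms(3) x'] by (metis four_simps(14))
  then have y': "y' = y" "j = j' + 1" using R(5) by auto
  have x_to_y: "fst (join D (x, k)) = y" if "k = i \<or> k = i + 1 \<or> k = i + 2" for k
    using that R R' y' by auto
  have y_to_x: "fst (join D (y, k)) = x" if "k = j' \<or> k = j' + 1 \<or> k = j' + 2" for k
    using that R R' y' by auto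
  obtain R'' where R'': "R'' \<in> bigons D" "fst ` R'' \<inter> fst ` R \<noteq> {}" "\<not> fst ` R'' \<subseteq> fst ` R"
    using bigon_continues[OF assms(1)] .
  then obtain z where "z \<in> fst ` R''" and z2: "z = x \<or> z = y" using R(1) by auto
  then obtain k where "(z, k) \<in> R''" by force
  with z2 have z: "(z, k) \<in> R''" "z = x \<or> z = y" by auto
  obtain w l where w: "R'' = {(z, k), (w, l)}" "join D (z, k) = (w, l + 1)" "join D (z, k + 1) = (w, l)"
    using R''(1) z(1) by (rule bigon_at)
  from z(2) have "w = x \<or> w = y"
  proof
    assume zx: "z = x"
    have "fst (join D (x, k)) = y \<or> fst (join D (x, k + 1)) = y"
      using four_cases_from[of k i] x_to_y[of k] x_to_y[of "k + 1"] by auto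
    then show ?thesis using w zx by auto
  next
    assume zy: "z = y"
    have "fst (join D (y, k)) = x \<or> fst (join D (y, k + 1)) = x"
      using four_cases_from[of k j'] y_to_x[of k] y_to_x[of "k + 1"] by auto
    then show ?thesis using w zy by auto
  qed
  then have "fst ` R'' \<subseteq> fst ` R" using w(1) z(2) R(1) by auto
  then show False using R''(3) by simp
qed

lemma bigons_at_crossing:
  assumes "R \<in> bigons D" "(x, i) \<in> R" "R' \<in> bigons D" "(x, k) \<in> R'"
  shows "k = i \<or> k = i + 2"
  using no_adjacent_bigons[OF assms(1-3)] no_adjacent_bigons[OF assms(3,4,1)]
    four_cases_from[of k i] assms by auto

text \<open>
  The bigons at a crossing are cut off either by its \<open>A\<close>-resolution or by its \<open>B\<close>-resolution. In the
  former case, they are circles of the all-\<open>A\<close> state, and the crossings of the twist region form a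
  path or a cycle in the state graph \<open>\<G>\<^sub>A\<close> and parallel edges in the state graph \<open>\<G>\<^sub>B\<close>.
\<close>

definition long :: "resolution \<Rightarrow> 'a set" where
  "long \<rho> = {x \<in> X. \<exists>R\<in>bigons D. \<exists>i. (x, i) \<in> R \<and> cuts \<rho> i}"

lemma long_iff:
  assumes "R \<in> bigons D" "(x, i) \<in> R" shows "x \<in> long \<rho> \<longleftrightarrow> cuts \<rho> i"
proof
  assume "x \<in> long \<rho>"
  then obtain R' k where "R' \<in> bigons D" "(x, k) \<in> R'" "cuts \<rho> k" by (auto simp: long_def)
  then show "cuts \<rho> i" using bigons_at_crossing[OF assms, of R' k] by auto
qed (use assms bigon_subset[OF assms(1)] in \<open>auto simp: long_def\<close>)

lemma long_opposite: "x \<in> X \<Longrightarrow> x \<in> long (opposite \<rho>) \<longleftrightarrow> x \<notin> long \<rho>"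
  by (rule crossing_in_bigon) (auto simp: long_iff)

lemma long_subset: "long \<rho> \<subseteq> X"
  by (auto simp: long_def)

lemma long_opposite_eq: "long (opposite \<rho>) = X - long \<rho>"
  using long_opposite long_subset by blast

lemma bigon_circle:
  assumes R: "R \<in> bigons D" "(x, i) \<in> R" "(y, j) \<in> R" "(x, i) \<noteq> (y, j)"
    and \<rho>: "cuts \<rho> i"
  shows "circ \<rho> (x, i) = {(x, i), (x, i + 1), (y, j), (y, j + 1)}"
proof -
  obtain z k where "R = {(x, i), (z, k)}" "x \<in> X" "z \<in> X"
      "join D (x, i) = (z, k + 1)" "join D (x, i + 1) = (z, k)"
      "join D (z, k + 1) = (x, i)" "join D (z, k) = (x, i + 1)"
    using R(1,2) by (rule bigon_at)
  moreover from this have "z = y" "k = j" using R by auto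
  ultimately have j: "x \<in> X" "y \<in> X" "join D (x, i) = (y, j + 1)" "join D (x, i + 1) = (y, j)"
      "join D (y, j + 1) = (x, i)" "join D (y, j) = (x, i + 1)"
    by auto
  have \<rho>': "cuts \<rho> j" using bigon_cuts[OF R(1,2,3)] \<rho> by simp
  let ?Q = "{(x, i), (x, i + 1), (y, j), (y, j + 1)}"
  show ?thesis
  proof (intro equalityI subsetI)
    fix e assume "e \<in> circ \<rho> (x, i)"
    then have "curve_linked (\<lambda>_. \<rho>) {} (x, i) e" by (simp add: in_circ)
    then show "e \<in> ?Q"
    proof (induction rule: linked_induct)
      case (step u v)
      from step.hyps(2,3,4) show ?case
      proof (cases rule: curve_rel_cases)
        case 1
        then show ?thesis using step.IH j by auto
      next
        case (2 z k)
        then show ?thesis using step.IH \<rho> \<rho>' by (auto simp: reconnect_eq)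
      qed
    qed simp
  next
    fix e assume e: "e \<in> ?Q"
    have "circ \<rho> (x, i + 1) = circ \<rho> (x, i)" "circ \<rho> (y, j + 1) = circ \<rho> (x, i)"
        "circ \<rho> (y, j) = circ \<rho> (x, i + 1)"
      using circ_reconnect[OF j(1), of \<rho> i] circ_join[of "(x, i)" \<rho>] circ_join[of "(x, i + 1)" \<rho>] j \<rho>
      by (simp_all add: reconnect_eq)
    then have "circ \<rho> (x, i) = circ \<rho> e" using e by auto
    then show "e \<in> circ \<rho> (x, i)" by (simp add: circ_eq_iff in_circ)
  qed
qed

lemma ends_at_bigon:
  assumes "R \<in> bigons D" "(x, i) \<in> R" "(y, j) \<in> R" "\<not> cuts \<rho> i"
  shows "ends_at \<rho> x = ends_at \<rho> y"
proof (cases "(x, i) = (y, j)")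
  case False
  obtain z k where z: "R = {(x, i), (z, k)}" "x \<in> X" "z \<in> X"
      "join D (x, i) = (z, k + 1)" "join D (x, i + 1) = (z, k)"
    using assms(1,2) by (rule bigon_at)
  moreover have "z = y" "k = j" using False z(1) assms(3) by auto
  ultimately have j: "x \<in> X" "y \<in> X" "join D (x, i) = (y, j + 1)" "join D (x, i + 1) = (y, j)"
    by auto
  have "\<not> cuts \<rho> j" using bigon_cuts[OF assms(1-3)] assms(4) by simp
  then have "circ \<rho> (x, i + 1) = circ \<rho> (x, i + 2)" "circ \<rho> (y, j + 1) = circ \<rho> (y, j + 2)"
    using circ_reconnect[OF j(1), of \<rho> "i + 1"] circ_reconnect[OF j(2), of \<rho> "j + 1"] assms(4)
    by (simp_all add: reconnect_eq)
  moreover have "circ \<rho> (y, j + 1) = circ \<rho> (x, i)" "circ \<rho> (y, j) = circ \<rho> (x, i + 1)"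
    using circ_join[of "(x, i)" \<rho>] circ_join[of "(x, i + 1)" \<rho>] j by simp_all
  ultimately show ?thesis
    using ends_at_eq[OF j(1), of \<rho> i] ends_at_eq[OF j(2), of \<rho> j] by (simp add: insert_commute)
qed simp

text \<open>
  If the twist region continues beyond \<open>x\<close>, then the circle \<open>circ \<rho> (x, i + 2)\<close> bounds the next bigon,
  and if it also touches \<open>y\<close>, then this bigon leads back to \<open>y\<close>.
\<close>

lemma parallel_bigon_closed:
  assumes R: "R \<in> bigons D" "R = {(x, i), (y, j)}" "cuts \<rho> i"
    and c: "circ \<rho> (x, i + 2) = circ \<rho> (y, j + 2)"
    and R': "R' \<in> bigons D" "(x, k) \<in> R'"
  shows "fst ` R' \<subseteq> {x, y}"
proof -
  have x: "(x, i) \<in> R" using R(2) by simp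
  have xy: "x \<noteq> y" using R(2) by (rule_tac bigon_at[OF R(1) x]) auto
  from bigons_at_crossing[OF R(1) x R'] show ?thesis
  proof
    assume "k = i"
    then have "R' = R" using bigons_disjoint[OF R'(1) R(1) R'(2)] x by simp
    then show ?thesis using R(2) by auto
  next
    assume k: "k = i + 2"
    obtain w l where w: "R' = {(x, k), (w, l)}" "x \<noteq> w" using R' by (rule bigon_at)
    have "circ \<rho> (x, k) = {(x, k), (x, k + 1), (w, l), (w, l + 1)}"
      using R' w R(3) k by (intro bigon_circle[of R']) auto
    moreover have "(y, j + 2) \<in> circ \<rho> (x, k)" using c k by (simp add: in_circ)
    ultimately show ?thesis using w xy by auto
  qed
qed

text \<open>
  The circle of a bigon at \<open>x\<close> touches only one other crossing \<open>y\<close>, so only \<open>y\<close> could be parallel to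
  \<open>x\<close>. But then the twist region could not continue beyond \<open>x\<close> and \<open>y\<close>.
\<close>

lemma ends_at_long_unique:
  assumes x: "x \<in> long \<rho>" and z: "z \<in> X" and eq: "ends_at \<rho> z = ends_at \<rho> x"
  shows "z = x"
proof (rule ccontr)
  assume "z \<noteq> x"
  obtain R i where R: "R \<in> bigons D" "(x, i) \<in> R" "cuts \<rho> i" using x by (auto simp: long_def)
  obtain y j where y: "R = {(x, i), (y, j)}" "x \<in> X" "y \<in> X" "x \<noteq> y"
    using R(1,2) by (rule bigon_at)
  have cj: "cuts \<rho> j" using bigon_cuts[OF R(1,2), of y j] y(1) R(3) by simp
  have C: "circ \<rho> (x, i) = {(x, i), (x, i + 1), (y, j), (y, j + 1)}"
    by (rule bigon_circle[OF R(1,2) _ _ R(3)]) (use y in auto)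
  have "circ \<rho> (x, i) \<in> ends_at \<rho> z" using ends_at_eq[OF y(2), of \<rho> i] eq by simp
  then obtain k where "circ \<rho> (z, k) = circ \<rho> (x, i)" by (auto simp: ends_at_def)
  then have "(z, k) \<in> circ \<rho> (x, i)" by (metis in_circ linked_refl)
  then have "z = y" using C \<open>z \<noteq> x\<close> by auto
  have "circ \<rho> (y, j) = circ \<rho> (x, i)"
    using C circ_eq_iff[of \<rho> "(x, i)" "(y, j)"] in_circ[of "(y, j)" \<rho> "(x, i)"] by auto
  then have "{circ \<rho> (x, i), circ \<rho> (y, j + 2)} = {circ \<rho> (x, i), circ \<rho> (x, i + 2)}"
    using ends_at_eq[OF y(2), of \<rho> i] ends_at_eq[OF y(3), of \<rho> j] eq \<open>z = y\<close> by simp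
  then have c: "circ \<rho> (x, i + 2) = circ \<rho> (y, j + 2)"
    by (auto simp: doubleton_eq_iff)
  obtain R' where R': "R' \<in> bigons D" "fst ` R' \<inter> fst ` R \<noteq> {}" "\<not> fst ` R' \<subseteq> fst ` R"
    using bigon_continues[OF R(1)] .
  then obtain w where "w \<in> fst ` R'" and w2: "w = x \<or> w = y" using y(1) by auto
  then obtain l where "(w, l) \<in> R'" by force
  with w2 have w: "(w, l) \<in> R'" "w = x \<or> w = y" by auto
  from w(2) have "fst ` R' \<subseteq> {x, y}"
  proof
    assume "w = x"
    then show ?thesis using parallel_bigon_closed[OF R(1) y(1) R(3) c R'(1)] w(1) by simp
  next
    assume "w = y"
    then have "fst ` R' \<subseteq> {y, x}"
      using parallel_bigon_closed[of R y j x i \<rho> R' l] R(1) y(1) cj c R'(1) w(1) by (simp add: insert_commute)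
    then show ?thesis by auto
  qed
  then show False using R'(3) y(1) by simp
qed

text \<open>
  The twist regions that are not long for \<open>\<rho>\<close> are bundles of parallel edges of the state graph; bundles
  with the same ends count once.
\<close>

definition short_classes :: "resolution \<Rightarrow> nat" where
  "short_classes \<rho> = card (ends_at \<rho> ` long (opposite \<rho>))"

lemma card_reduced_edges: "card (ends_at \<rho> ` X) = card (long \<rho>) + short_classes \<rho>"
proof -
  have X: "X = long \<rho> \<union> long (opposite \<rho>)" using long_opposite_eq long_subset by blast
  have fin: "finite (long \<rho>)" "finite (long (opposite \<rho>))"
    using finite_subset[OF long_subset finite_X] by auto
  have inj: "inj_on (ends_at \<rho>) (long \<rho>)"
  proof (rule inj_onI)
    show "x = y" if "x \<in> long \<rho>" "y \<in> long \<rho>" "ends_at \<rho> x = ends_at \<rho> y" for x y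
      using ends_at_long_unique[OF that(2) _ that(3)] that(1) long_subset by blast
  qed
  have "ends_at \<rho> ` X = ends_at \<rho> ` long \<rho> \<union> ends_at \<rho> ` long (opposite \<rho>)"
    using X image_Un[of "ends_at \<rho>" "long \<rho>" "long (opposite \<rho>)"] by simp
  moreover have "ends_at \<rho> ` long \<rho> \<inter> ends_at \<rho> ` long (opposite \<rho>) = {}"
  proof -
    have "ends_at \<rho> z \<noteq> ends_at \<rho> x" if "x \<in> long \<rho>" "z \<in> long (opposite \<rho>)" for x z
      using ends_at_long_unique[OF that(1), of z] that long_opposite_eq[of \<rho>] by auto
    then show ?thesis by fastforce
  qed
  ultimately show ?thesis
    using fin card_image[OF inj] by (simp add: card_Un_disjoint short_classes_def)
qed

lemma card_long: "card (long \<rho>) + card (long (opposite \<rho>)) = card X"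
  using card_Un_disjoint[of "long \<rho>" "long (opposite \<rho>)"] long_opposite_eq[of \<rho>] long_subset[of \<rho>]
    finite_subset[OF long_subset finite_X] by (simp add: Un_absorb1)

section \<open>Counting twist regions\<close>

definition bigon_rel :: "('a \<times> 'a) set" where
  "bigon_rel = {(x, y). \<exists>R\<in>bigons D. \<exists>i j. (x, i) \<in> R \<and> (y, j) \<in> R}"

lemma bigon_rel_linked:
  assumes "R \<in> bigons D" "x \<in> fst ` R" "y \<in> fst ` R" shows "linked X bigon_rel x y"
proof (rule linked_step)
  obtain i j where "(x, i) \<in> R" "(y, j) \<in> R" using assms(2,3) by force
  then show "(x, y) \<in> bigon_rel" using assms(1) unfolding bigon_rel_def by blast
qed (use assms bigon_subset[OF assms(1)] in \<open>auto simp: darts_def\<close>)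

lemma twist_region_eq:
  assumes C: "\<C> \<in> components (bigons D) (end_to_end D)" and x: "x \<in> fst ` \<Union>\<C>"
  shows "fst ` \<Union>\<C> = {y. linked X bigon_rel x y}"
proof (intro equalityI subsetI)
  obtain R where R: "R \<in> \<C>" "x \<in> fst ` R" using x by auto
  fix y assume "y \<in> fst ` \<Union>\<C>"
  then obtain R' where R': "R' \<in> \<C>" "y \<in> fst ` R'" by auto
  have "linked (bigons D) (end_to_end D) R R'" using in_component[OF C R(1)] R'(1) by auto
  then have "\<forall>y\<in>fst ` R'. linked X bigon_rel x y"
  proof (induction rule: linked_induct)
    case refl
    have "R \<in> bigons D" using component_subset[OF C] R(1) by auto
    then show ?case using bigon_rel_linked[of R x] R(2) by blast
  next
    case (step R1 R2)
    then obtain z k l where "(z, k) \<in> R1" "(z, l) \<in> R2" by (auto simp: end_to_end_def)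
    then have "z \<in> fst ` R1" "z \<in> fst ` R2" by force+
    then show ?case
      using linked_trans[OF bspec[OF step.IH] bigon_rel_linked[OF step.hyps(4)]] by blast
  qed
  then show "y \<in> {y. linked X bigon_rel x y}" using R'(2) by blast
next
  fix y assume "y \<in> {y. linked X bigon_rel x y}"
  then have "linked X bigon_rel x y" by simp
  then show "y \<in> fst ` \<Union>\<C>" using x
  proof (rule linked_closed)
    have "v \<in> fst ` \<Union>\<C>" if uv: "R \<in> bigons D" "(u, i) \<in> R" "(v, j) \<in> R" "u \<in> fst ` \<Union>\<C>" for R u v i j
    proof -
      obtain R' k where R': "R' \<in> \<C>" "(u, k) \<in> R'" using uv(4) by auto
      then have R'b: "R' \<in> bigons D" using component_subset[OF C] by auto
      have "R = R' \<or> (R', R) \<in> end_to_end D"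
        using bigons_at_crossing[OF R'b R'(2) uv(1,2)] bigons_disjoint[OF uv(1) R'b uv(2)] R'(2) uv(2)
        by (auto simp: end_to_end_def)
      then have "linked (bigons D) (end_to_end D) R' R"
        using R'b uv(1) by (auto intro: linked_step)
      then have "R \<in> \<C>" using component_closed[OF C R'(1)] by simp
      then show ?thesis using uv(3) by force
    qed
    then show "u \<in> fst ` \<Union>\<C> \<longleftrightarrow> v \<in> fst ` \<Union>\<C>" if "(u, v) \<in> bigon_rel" for u v
      using that unfolding bigon_rel_def by blast
  qed
qed

text \<open>
  The bigons at a crossing are end to end, so twist regions can be described in terms of crossings
  alone. In particular, they partition the set of crossings.
\<close>

lemma twist_regions_eq: "twist_regions D = components X bigon_rel"
proof (intro equalityI subsetI)
  fix T assume "T \<in> twist_regions D"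
  moreover have "\<exists>R\<in>bigons D. x \<in> fst ` R" if "x \<in> X" for x
    using crossing_in_bigon[OF that] by (metis fst_conv image_eqI)
  ultimately obtain \<C> where C: "\<C> \<in> components (bigons D) (end_to_end D)" "T = fst ` \<Union>\<C>"
    unfolding twist_regions_def by blast
  then obtain R where "R \<in> \<C>" using component_nonempty by blast
  then have "R \<in> bigons D" using component_subset[OF C(1)] by auto
  then obtain d where d: "d \<in> R" "d \<in> S"
    using bigon_subset by (fastforce simp: bigons_def card_2_iff)
  then have "fst d \<in> T" "fst d \<in> X" using C \<open>R \<in> \<C>\<close> by (auto simp: darts_def)
  then show "T \<in> components X bigon_rel"
    using twist_region_eq[OF C(1)] C(2) component_of_in[of "fst d" X bigon_rel] by simp
next
  fix T assume "T \<in> components X bigon_rel"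
  then obtain x where x: "x \<in> X" "T = {y. linked X bigon_rel x y}" by (auto simp: components_eq)
  obtain R i where R: "R \<in> bigons D" "(x, i) \<in> R" using crossing_in_bigon[OF x(1)] .
  let ?C = "{R'. linked (bigons D) (end_to_end D) R R'}"
  have C: "?C \<in> components (bigons D) (end_to_end D)" using R(1) by (rule component_of_in)
  have "R \<in> ?C" by simp
  then have "x \<in> fst ` \<Union>?C" using R(2) by force
  then have "T = fst ` \<Union>?C" using twist_region_eq[OF C] x(2) by simp
  then show "T \<in> twist_regions D" using C unfolding twist_regions_def by blast
qed

lemma tw_eq: "tw D = ncomp X bigon_rel"
  by (simp add: tw_def ncomp_def twist_regions_eq)

lemma finite_twist_regions: "finite (twist_regions D)"
  unfolding twist_regions_eq by (rule finite_components) simp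

lemma tw_pos: "tw D \<ge> 1"
proof -
  obtain x where "x \<in> X" using X_nonempty by auto
  then have "{y. linked X bigon_rel x y} \<in> twist_regions D"
    unfolding twist_regions_eq by (rule component_of_in)
  then have "card (twist_regions D) \<noteq> 0" using finite_twist_regions by auto
  then show ?thesis by (simp add: tw_def)
qed

text \<open>Each short twist region lies in one class of parallel edges.\<close>

lemma short_classes_le:
  "short_classes \<rho> \<le> card {T \<in> twist_regions D. T \<subseteq> long (opposite \<rho>)}"
proof -
  let ?L = "long (opposite \<rho>)" and ?\<T> = "{T \<in> twist_regions D. T \<subseteq> long (opposite \<rho>)}"
  have "ends_at \<rho> ` ?L \<subseteq> (\<lambda>T. ends_at \<rho> (SOME x. x \<in> T)) ` ?\<T>"
  proof (rule image_subsetI)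
    fix x assume x: "x \<in> ?L"
    let ?T = "{y. linked X bigon_rel x y}"
    have same: "y \<in> {y \<in> ?L. ends_at \<rho> y = ends_at \<rho> x}" if "linked X bigon_rel x y" for y
      using that
    proof (rule linked_closed)
      fix u v assume "(u, v) \<in> bigon_rel"
      then obtain R i j where R: "R \<in> bigons D" "(u, i) \<in> R" "(v, j) \<in> R"
        unfolding bigon_rel_def by blast
      have L: "u \<in> ?L \<longleftrightarrow> \<not> cuts \<rho> i" "v \<in> ?L \<longleftrightarrow> \<not> cuts \<rho> i"
        using long_iff[OF R(1,2), of "opposite \<rho>"] long_iff[OF R(1,3), of "opposite \<rho>"]
          bigon_cuts[OF R, of \<rho>] by simp_all
      show "u \<in> {y \<in> ?L. ends_at \<rho> y = ends_at \<rho> x} \<longleftrightarrow> v \<in> {y \<in> ?L. ends_at \<rho> y = ends_at \<rho> x}"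
        using L ends_at_bigon[OF R, of \<rho>] by auto
    qed (use x in simp)
    have "?T \<in> twist_regions D"
      unfolding twist_regions_eq using x long_subset by (intro component_of_in) auto
    then have T: "?T \<in> ?\<T>" using same by auto
    have "(SOME y. y \<in> ?T) \<in> ?T" by (rule someI[of _ x]) simp
    then have "linked X bigon_rel x (SOME y. y \<in> ?T)" by (rule CollectD)
    from same[OF this] have "ends_at \<rho> x = ends_at \<rho> (SOME y. y \<in> ?T)" by simp
    then show "ends_at \<rho> x \<in> (\<lambda>T. ends_at \<rho> (SOME x. x \<in> T)) ` ?\<T>" using T by (rule image_eqI)
  qed
  then show ?thesis unfolding short_classes_def
    using finite_twist_regions surj_card_le[of ?\<T>] by simp
qed

lemma short_classes_sum_le: "short_classes ResA + short_classes ResB \<le> tw D"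
proof -
  let ?\<T> = "\<lambda>\<rho>. {T \<in> twist_regions D. T \<subseteq> long \<rho>}"
  have "?\<T> ResA \<inter> ?\<T> ResB = {}"
  proof -
    have "long ResA \<inter> long ResB = {}" using long_opposite_eq[of ResA] by auto
    moreover have "T \<noteq> {}" if "T \<in> twist_regions D" for T
      using that component_nonempty[of T X bigon_rel] unfolding twist_regions_eq by blast
    ultimately show ?thesis by blast
  qed
  then have "card (?\<T> ResB) + card (?\<T> ResA) = card (?\<T> ResA \<union> ?\<T> ResB)"
    using finite_twist_regions by (simp add: card_Un_disjoint)
  also have "\<dots> \<le> tw D" unfolding tw_def using finite_twist_regions by (intro card_mono) auto
  finally show ?thesis using short_classes_le[of ResA] short_classes_le[of ResB] by simp
qed

text \<open>
  The bigons connect the crossings of each twist region, so there are enough of them for a spanning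
  forest with \<open>tw D\<close> trees.
\<close>

lemma card_crossings_le: "card X \<le> tw D + card (bigons D)"
proof -
  define f where "f R = (SOME p. \<exists>i j. R = {(fst p, i), (snd p, j)})" for R :: "'a dart set"
  have f: "\<exists>i j. R = {(fst (f R), i), (snd (f R), j)}" if R: "R \<in> bigons D" for R
  proof -
    obtain d where "d \<in> R" using R by (fastforce simp: bigons_def card_2_iff)
    then obtain x i where "(x, i) \<in> R" by (cases d) auto
    then obtain y j where "R = {(x, i), (y, j)}" using bigon_at[OF R] by metis
    then have "\<exists>i j. R = {(fst (x, y), i), (snd (x, y), j)}" by auto
    then show ?thesis unfolding f_def by (rule someI)
  qed
  have "components X bigon_rel = components X ({} \<union> f ` bigons D)"
  proof (rule components_cong')
    fix u v assume uv: "(u, v) \<in> bigon_rel" "u \<in> X" "v \<in> X"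
    then obtain R i j where R: "R \<in> bigons D" "(u, i) \<in> R" "(v, j) \<in> R"
      unfolding bigon_rel_def by blast
    then have "u = v \<or> f R = (u, v) \<or> f R = (v, u)" using f[OF R(1)] by (cases "f R") auto
    moreover have "f R \<in> {} \<union> f ` bigons D" using R(1) by simp
    ultimately show "linked X ({} \<union> f ` bigons D) u v"
      using uv by (metis linked_refl linked_step linked_sym)
  next
    fix u v assume uv: "(u, v) \<in> {} \<union> f ` bigons D" "u \<in> X" "v \<in> X"
    then obtain R where R: "R \<in> bigons D" "f R = (u, v)" by (auto simp: eq_commute)
    then have "u \<in> fst ` R \<and> v \<in> fst ` R" using f[OF R(1)] by force
    then show "linked X bigon_rel u v" using bigon_rel_linked[OF R(1)] by blast
  qed
  then have "tw D = ncomp X ({} \<union> f ` bigons D)" by (simp add: tw_eq ncomp_def)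
  moreover have "ncomp X {} \<le> ncomp X ({} \<union> f ` bigons D) + card (f ` bigons D)"
    using finite_bigons by (intro ncomp_Un_le) auto
  moreover have "card (f ` bigons D) \<le> card (bigons D)" using finite_bigons by (rule card_image_le)
  moreover have "ncomp X {} = card X"
  proof -
    have "linked X {} a b \<longleftrightarrow> a = b" for a b
      using linked_closed[of X "{}" a b "{a}"] by auto
    then have "components X {} = (\<lambda>x. {x}) ` X" by (simp add: components_eq)
    then show ?thesis by (simp add: ncomp_def card_image)
  qed
  ultimately show ?thesis by simp
qed

lemma bigon_corners_le: "card {i. (x, i) \<in> \<Union>(bigons D)} \<le> 2"
proof (cases "\<exists>i. (x, i) \<in> \<Union>(bigons D)")
  case True
  then obtain i where "(x, i) \<in> \<Union>(bigons D)" by auto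
  then have "{i. (x, i) \<in> \<Union>(bigons D)} \<subseteq> {i, i + 2}" using bigons_at_crossing by blast
  then have "card {i. (x, i) \<in> \<Union>(bigons D)} \<le> card {i, i + 2}" by (intro card_mono) auto
  then show ?thesis by simp
qed simp

lemma card_Union_bigons: "card (\<Union>(bigons D)) = 2 * card (bigons D)"
proof -
  have "card (\<Union>(bigons D)) = (\<Sum>R\<in>bigons D. card R)"
  proof (rule card_Union_disjoint)
    show "pairwise disjnt (bigons D)"
      unfolding pairwise_def disjnt_def using bigons_disjoint by blast
    show "finite R" if "R \<in> bigons D" for R
      using finite_subset[OF bigon_subset[OF that] finite_S] .
  qed
  also have "\<dots> = (\<Sum>R\<in>bigons D. 2)" by (rule sum.cong) (auto simp: bigons_def)
  finally show ?thesis by simp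
qed

lemma card_bigon_corners_in:
  "card {d \<in> \<Union>(bigons D). fst d \<in> T} = (\<Sum>x\<in>T. card {i. (x, i) \<in> \<Union>(bigons D)})" if "finite T"
proof -
  have "{d \<in> \<Union>(bigons D). fst d \<in> T} = (SIGMA x:T. {i. (x, i) \<in> \<Union>(bigons D)})" by auto
  then show ?thesis using that by (simp add: card_SigmaI)
qed

lemma card_bigons_le: "card (bigons D) \<le> card X"
proof -
  have "\<Union>(bigons D) = {d \<in> \<Union>(bigons D). fst d \<in> X}"
    using bigon_subset by (fastforce simp: darts_def)
  then have "2 * card (bigons D) = (\<Sum>x\<in>X. card {i. (x, i) \<in> \<Union>(bigons D)})"
    using card_Union_bigons card_bigon_corners_in[of X] by simp
  also have "\<dots> \<le> (\<Sum>x\<in>X. 2)" by (intro sum_mono bigon_corners_le)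
  finally show ?thesis by simp
qed

text \<open>
  If there is more than one twist region, then the bigons of a twist region do not close up to a
  cycle, because the crossings in such a cycle have no edges to other crossings.
\<close>

lemma tw_add_bigons_le:
  assumes "tw D \<ge> 2" shows "tw D + card (bigons D) \<le> card X"
proof -
  let ?K = "\<lambda>T. {d \<in> \<Union>(bigons D). fst d \<in> T}" and ?I = "\<lambda>x. {i. (x, i) \<in> \<Union>(bigons D)}"
  have finT: "finite T" if "T \<in> twist_regions D" for T
    using that component_subset[of T X bigon_rel] finite_subset[OF _ finite_X]
    by (simp add: twist_regions_eq)
  have le: "card (?K T) + 2 \<le> 2 * card T" if T: "T \<in> twist_regions D" for T
  proof -
    have T': "T \<in> components X bigon_rel" using T by (simp add: twist_regions_eq)
    have closed: "y \<in> T" if "R \<in> bigons D" "(x, i) \<in> R" "(y, j) \<in> R" "x \<in> T" for R x y i j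
      using component_closed[OF T' that(4)] bigon_rel_linked[OF that(1)] that(2,3) by force
    have "even (card (?K T))"
    proof (rule even_card_involution[where f = "next_side D"])
      show "finite (?K T)"
        using finite_subset[OF _ finite_S] bigon_subset by (metis (no_types, lifting) Sup_least mem_Collect_eq subsetI subsetD)
      fix d assume d: "d \<in> ?K T"
      then obtain R where R: "R \<in> bigons D" "d \<in> R" "fst d \<in> T" by auto
      have n: "next_side D d \<in> R" using bigon_next_side(1)[OF R(1,2)] by auto
      have "fst (next_side D d) \<in> T"
        using closed[OF R(1), of "fst d" "snd d" "fst (next_side D d)" "snd (next_side D d)"] R n by simp
      then show "next_side D d \<in> ?K T \<and> next_side D d \<noteq> d \<and> next_side D (next_side D d) = d"
        using bigon_next_side(2,3)[OF R(1,2)] n R(1) by auto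
    qed
    moreover have "card (?K T) < 2 * card T"
    proof (rule ccontr)
      assume ge: "\<not> card (?K T) < 2 * card T"
      \<comment> \<open>then all four edges at a crossing of \<open>T\<close> belong to bigons and stay in \<open>T\<close>\<close>
      have two: "card (?I x) = 2" if x: "x \<in> T" for x
      proof (rule ccontr)
        assume "card (?I x) \<noteq> 2"
        then have "card (?I x) < 2" using bigon_corners_le[of x] by simp
        then have "(\<Sum>x\<in>T. card (?I x)) < (\<Sum>x\<in>T. 2)"
          by (intro sum_strict_mono_ex1) (use finT[OF T] bigon_corners_le x in auto)
        then show False using ge card_bigon_corners_in[OF finT[OF T]] by simp
      qed
      have adj: "y \<in> T" if xy: "x \<in> T" "(x, y) \<in> adjacent D" for x y
      proof -
        obtain k l where k: "join D (x, k) = (y, l)" "(x, k) \<in> S" using xy(2) by (auto simp: adjacent_def)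
        obtain a b where ab: "?I x = {a, b}" "a \<noteq> b" using two[OF xy(1)] by (auto simp: card_2_iff)
        then obtain Ra Rb where Rab: "Ra \<in> bigons D" "(x, a) \<in> Ra" "Rb \<in> bigons D" "(x, b) \<in> Rb"
          by blast
        then have "b = a + 2" using bigons_at_crossing[OF Rab] ab(2) by auto
        then have "k \<in> ?I x \<or> k - 1 \<in> ?I x" unfolding ab(1) using four_cases_from[of k a] by auto
        then show ?thesis
        proof
          assume "k \<in> ?I x"
          then obtain R where R: "R \<in> bigons D" "(x, k) \<in> R" by auto
          obtain z m where "R = {(x, k), (z, m)}" "join D (x, k) = (z, m + 1)" using R by (rule bigon_at)
          then show ?thesis using closed[OF R(1,2), of z m] k(1) xy(1) by auto
        next
          assume "k - 1 \<in> ?I x"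
          then obtain R where R: "R \<in> bigons D" "(x, k - 1) \<in> R" by auto
          obtain z m where "R = {(x, k - 1), (z, m)}" "join D (x, k - 1 + 1) = (z, m)"
            using R by (rule bigon_at)
          then show ?thesis using closed[OF R(1,2), of z m] k(1) xy(1) by auto
        qed
      qed
      obtain x where x: "x \<in> T" using component_nonempty[OF T'] by auto
      have "y \<in> T" if "y \<in> X" for y
      proof -
        have "(x, y) \<in> (adjacent D)\<^sup>*"
          using D that component_subset[OF T'] x by (auto simp: link_diagram_def)
        then show ?thesis by (induction rule: rtrancl_induct) (use x adj in auto)
      qed
      then have "twist_regions D \<subseteq> {T}"
        using components_disjoint[OF T'] component_nonempty component_subset
        unfolding twist_regions_eq by blast
      then have "tw D \<le> 1" unfolding tw_def using card_mono[of "{T}"] by fastforce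
      then show False using assms by simp
    qed
    ultimately show ?thesis by (elim evenE) simp
  qed
  have X: "\<Union>(twist_regions D) = X" unfolding twist_regions_eq by (rule Union_components)
  have "card (\<Union>(bigons D)) = card (?K X)"
    using bigon_subset by (intro arg_cong[of _ _ card]) (fastforce simp: darts_def)
  also have "\<dots> = card (\<Union>T\<in>twist_regions D. ?K T)"
    by (rule arg_cong[of _ _ card]) (use X in blast)
  also have "\<dots> \<le> (\<Sum>T\<in>twist_regions D. card (?K T))"
    using finite_twist_regions by (rule card_UN_le)
  finally have "card (\<Union>(bigons D)) + 2 * tw D \<le> (\<Sum>T\<in>twist_regions D. card (?K T) + 2)"
    by (simp only: sum.distrib) (simp add: tw_def)
  also have "\<dots> \<le> (\<Sum>T\<in>twist_regions D. 2 * card T)" using le by (rule sum_mono)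
  also have "\<dots> = 2 * card X"
    using sum_card_components[OF finite_X, of bigon_rel]
    by (simp add: sum_distrib_left[symmetric] twist_regions_eq)
  finally show ?thesis by (simp add: card_Union_bigons)
qed

section \<open>The bounds\<close>

definition bigons_of :: "resolution \<Rightarrow> 'a dart set set" where
  "bigons_of \<rho> = {R \<in> bigons D. \<forall>d\<in>R. cuts \<rho> (snd d)}"

lemma bigons_of_opposite: "bigons_of (opposite \<rho>) = bigons D - bigons_of \<rho>"
proof -
  have "(\<forall>d\<in>R. \<not> cuts \<rho> (snd d)) \<longleftrightarrow> \<not> (\<forall>d\<in>R. cuts \<rho> (snd d))" if R: "R \<in> bigons D" for R
  proof -
    obtain x i y j where "R = {(x, i), (y, j)}"
      using R by (fastforce simp: bigons_def card_2_iff)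
    then show ?thesis using bigon_cuts[OF R, of x i y j \<rho>] by auto
  qed
  then show ?thesis unfolding bigons_of_def by auto
qed

lemma card_bigons_of: "card (bigons_of ResA) + card (bigons_of ResB) = card (bigons D)"
proof -
  have "bigons_of ResA \<subseteq> bigons D" by (auto simp: bigons_of_def)
  then show ?thesis
    using bigons_of_opposite[of ResA] finite_bigons card_mono[OF finite_bigons, of "bigons_of ResA"]
    by (simp add: card_Diff_subset finite_subset)
qed

lemma bigons_of_circle:
  assumes "R \<in> bigons_of \<rho>"
  shows "R \<union> join D ` R \<in> circles D (\<lambda>_. \<rho>)" "card (R \<union> join D ` R) = 4"
    "{d \<in> R \<union> join D ` R. cuts \<rho> (snd d)} = R"
proof -
  have R: "R \<in> bigons D" using assms by (simp add: bigons_of_def)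
  obtain x i where x: "(x, i) \<in> R"
    using R by (fastforce simp: bigons_def card_2_iff)
  obtain y j where y: "R = {(x, i), (y, j)}" "x \<in> X" "y \<in> X" "x \<noteq> y"
      "join D (x, i) = (y, j + 1)" "join D (y, j) = (x, i + 1)"
    using R x by (rule bigon_at)
  have c: "cuts \<rho> i" "cuts \<rho> j" using assms y(1) by (auto simp: bigons_of_def)
  have U: "R \<union> join D ` R = {(x, i), (x, i + 1), (y, j), (y, j + 1)}" using y by auto
  moreover have "circ \<rho> (x, i) = {(x, i), (x, i + 1), (y, j), (y, j + 1)}"
    by (rule bigon_circle[OF R x _ _ c(1)]) (use y in auto)
  ultimately show "R \<union> join D ` R \<in> circles D (\<lambda>_. \<rho>)"
    using circ_in_circles[of "(x, i)" \<rho>] y(2) by simp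
  show "card (R \<union> join D ` R) = 4" unfolding U using y(4) by simp
  show "{d \<in> R \<union> join D ` R. cuts \<rho> (snd d)} = R" unfolding U using c y(1) by auto
qed

lemma finite_circles: "finite (circles D \<sigma>)"
  unfolding circles_eq by (rule finite_components) simp

lemma sum_card_circles: "(\<Sum>C\<in>circles D \<sigma>. card C) = 4 * card X"
  unfolding circles_eq by (simp add: sum_card_components card_S)

text \<open>
  The circles that bound bigons have four darts each. So they can be all circles of the state only if
  there are as many of them as crossings, because each crossing has four darts.
\<close>

lemma card_bigons_of_le:
  shows "card (bigons_of \<rho>) \<le> curves (\<lambda>_. \<rho>) {}"
    and "card (bigons_of \<rho>) = curves (\<lambda>_. \<rho>) {} \<Longrightarrow> card (bigons_of \<rho>) = card X"
proof -
  let ?f = "\<lambda>R. R \<union> join D ` R"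
  have inj: "inj_on ?f (bigons_of \<rho>)"
    by (rule inj_on_inverseI[where g = "\<lambda>C. {d \<in> C. cuts \<rho> (snd d)}"]) (rule bigons_of_circle(3))
  have sub: "?f ` bigons_of \<rho> \<subseteq> circles D (\<lambda>_. \<rho>)" using bigons_of_circle(1) by blast
  show "card (bigons_of \<rho>) \<le> curves (\<lambda>_. \<rho>) {}"
    using card_inj_on_le[OF inj sub finite_circles] by (simp add: card_circles)
  assume "card (bigons_of \<rho>) = curves (\<lambda>_. \<rho>) {}"
  then have "?f ` bigons_of \<rho> = circles D (\<lambda>_. \<rho>)"
    using sub finite_circles by (intro card_subset_eq) (simp_all add: card_image[OF inj] card_circles)
  then have "4 * card X = (\<Sum>C\<in>?f ` bigons_of \<rho>. card C)" by (simp add: sum_card_circles)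
  also have "\<dots> = (\<Sum>R\<in>bigons_of \<rho>. card (?f R))" by (simp add: sum.reindex[OF inj])
  also have "\<dots> = (\<Sum>R\<in>bigons_of \<rho>. 4)" using bigons_of_circle(2) by (intro sum.cong) auto
  finally show "card (bigons_of \<rho>) = card X" by simp
qed

lemma betti_eq:
  "betti \<rho> + int (curves (\<lambda>_. \<rho>) {}) = int (card (long \<rho>)) + int (short_classes \<rho>) + 1"
  by (simp add: betti_def card_reduced_edges)

text \<open>
  In the second case below, the bigons close up to one cycle and are all circles of one of the two
  states, but the other state has a circle, too.
\<close>

lemma betti_sum_le: "betti ResA + betti ResB \<le> 2 * int (tw D)"
proof -
  let ?v = "\<lambda>\<rho>. curves (\<lambda>_. \<rho>) {}" and ?b = "\<lambda>\<rho>. card (bigons_of \<rho>)"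
  have sum: "betti ResA + betti ResB + int (?v ResA) + int (?v ResB) \<le> int (card X) + int (tw D) + 2"
    using betti_eq[of ResA] betti_eq[of ResB] card_long[of ResA] short_classes_sum_le by simp
  show ?thesis
  proof (cases "?b ResA < ?v ResA \<and> ?b ResB < ?v ResB")
    case True
    then show ?thesis using sum card_bigons_of card_crossings_le by simp
  next
    case False
    then have "?b ResA = card X \<or> ?b ResB = card X"
      using card_bigons_of_le[of ResA] card_bigons_of_le[of ResB] by force
    then have "?b ResA + ?b ResB = card X" "?v ResA + ?v ResB \<ge> card X + 1"
      using card_bigons_of card_bigons_le card_bigons_of_le(1)[of ResA] card_bigons_of_le(1)[of ResB]
        curves_pos[of "\<lambda>_. ResA"] curves_pos[of "\<lambda>_. ResB"] by auto
    then show ?thesis using sum tw_pos by simp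
  qed
qed

text \<open>
  Each of the arcs of a circle contributes two darts. A circle with one arc would be a monogon, whose
  crossing would be a loop of a state graph. If a circle has two arcs, then its two edges connect the
  ends of the arcs either as in a bigon or crosswise. In the latter case, one region has two opposite
  corners at the first crossing, so this crossing would be a loop as well.
\<close>

lemma small_circle:
  assumes C: "C \<in> circles D \<sigma>"
  shows "card C \<ge> 4" and "card C < 6 \<Longrightarrow> C \<in> (\<lambda>R. R \<union> join D ` R) ` bigons D"
proof -
  have C': "C \<in> components S (curve_rel \<sigma> {})" using C by (simp add: circles_eq)
  have CS: "C \<subseteq> S" using component_subset[OF C'] .
  have finC: "finite C" using CS finite_S by (rule finite_subset)
  have joined: "join D d \<in> C" if "d \<in> C" for d
    using component_closed[OF C' that curve_linked_join] that CS by auto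
  have reconnected: "(x, reconnect (\<sigma> x) k) \<in> C" if "(x, k) \<in> C" for x k
    using component_closed[OF C' that curve_linked_reconnect] that CS by auto
  obtain x k where "(x, k) \<in> C" using component_nonempty[OF C'] by fastforce
  then obtain i where i: "(x, i) \<in> C" "cuts (\<sigma> x) i"
    using reconnected[of x k] by (cases "cuts (\<sigma> x) k") (auto simp: reconnect_eq)
  have x: "x \<in> X" using i CS by auto
  have i': "(x, i + 1) \<in> C" using reconnected[OF i(1)] i(2) by (simp add: reconnect_eq)
  let ?\<tau> = "opposite (\<sigma> x)"
  have no_monogon: "join D (x, i) \<noteq> (x, i + 1)"
  proof
    assume "join D (x, i) = (x, i + 1)"
    then have "circ ?\<tau> (x, i) = circ ?\<tau> (x, i + 1)" using circ_join[of "(x, i)" ?\<tau>] x by simp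
    also have "\<dots> = circ ?\<tau> (x, i + 2)"
      using circ_reconnect[OF x, of ?\<tau> "i + 1"] i(2) by (simp add: reconnect_eq)
    finally show False using circles_separated[OF x] circ_eq_iff by blast
  qed
  have no_monogon': "join D (x, i + 1) \<noteq> (x, i)"
    using no_monogon join_join[of "(x, i + 1)"] x by (metis in_darts)
  let ?Q = "{(x, i), (x, i + 1), join D (x, i), join D (x, i + 1)}"
  have Q: "?Q \<subseteq> C" using i i' joined by auto
  have "join D (x, i) \<noteq> join D (x, i + 1)" using x by (simp add: join_eq_iff)
  then have cQ: "card ?Q = 4"
    using no_monogon[symmetric] no_monogon'[symmetric] join_neq[of "(x, i)", symmetric]
      join_neq[of "(x, i + 1)", symmetric] x by (simp add: card_insert_if)
  show "card C \<ge> 4" using card_mono[OF finC Q] cQ by simp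
  assume small: "card C < 6"
  have "C = ?Q"
  proof (rule ccontr)
    assume "C \<noteq> ?Q"
    then obtain e where e: "e \<in> C" "e \<notin> ?Q" using Q by blast
    then have eS: "e \<in> S" using CS by auto
    have "join D e \<notin> ?Q"
    proof
      assume "join D e \<in> ?Q"
      then have "join D (join D e) \<in> join D ` ?Q" by (rule imageI)
      then show False using e(2) eS x by auto
    qed
    then have c6: "card (insert e (insert (join D e) ?Q)) = 6"
      using e(2) eS cQ join_neq[OF eS, symmetric] by (simp add: card_insert_if)
    have sub: "insert e (insert (join D e) ?Q) \<subseteq> C" using Q e(1) joined by auto
    show False using card_mono[OF finC sub] c6 small by linarith
  qed
  obtain y k where y: "join D (x, i) = (y, k)" by fastforce
  have yX: "y \<in> X" using join_in[of "(x, i)"] y x by simp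
  have "(y, reconnect (\<sigma> y) k) \<in> ?Q" using reconnected[of y k] joined[OF i(1)] y \<open>C = ?Q\<close> by simp
  moreover have "(y, reconnect (\<sigma> y) k) \<noteq> (x, i)"
  proof
    assume "(y, reconnect (\<sigma> y) k) = (x, i)"
    then have "y = x" "reconnect (\<sigma> x) i = k" by auto
    then show False using no_monogon y i(2) by (simp add: reconnect_eq)
  qed
  moreover have "(y, reconnect (\<sigma> y) k) \<noteq> (x, i + 1)"
  proof
    assume "(y, reconnect (\<sigma> y) k) = (x, i + 1)"
    then have "y = x" "reconnect (\<sigma> x) k = i + 1" by auto
    moreover from this(2) have "reconnect (\<sigma> x) (i + 1) = k" by (metis reconnect_simps(1))
    ultimately show False using join_neq[of "(x, i)"] y x i(2) by (simp add: reconnect_eq)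
  qed
  ultimately have y': "join D (x, i + 1) = (y, reconnect (\<sigma> y) k)" using y by auto
  show "C \<in> (\<lambda>R. R \<union> join D ` R) ` bigons D"
  proof (cases "cuts (\<sigma> y) k")
    case True
    have "next_side D (x, i + 1) = (y, k)" "next_side D (y, k) = (x, i - 1)"
      using y y' True x join_join[of "(x, i)"] by (simp_all add: next_side_eq reconnect_eq)
    then have "region_linked \<sigma> X (x, i + 1) (x, i - 1)"
      using region_linked_next_side[of "(x, i + 1)" \<sigma> X] region_linked_next_side[of "(y, k)" \<sigma> X] x yX
      by (simp add: next_side_eq[symmetric]) (rule linked_trans)
    then have "curve_linked (\<lambda>_. ?\<tau>) {} (x, 0) (x, 0 + 2)"
      by (intro nugatory_one_circle[where \<sigma> = \<sigma> and i = i] x i(2)) simp_all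
    then show ?thesis using circles_separated[OF x] by blast
  next
    case False
    let ?R = "{(x, i), (y, k - 1)}"
    have 1: "join D (x, i) = (y, k - 1 + 1)" "join D (x, i + 1) = (y, k - 1)"
      using y y' False by (simp_all add: reconnect_eq)
    then have 2: "join D (y, k - 1) = (x, i + 1)" using join_join[of "(x, i + 1)"] x by simp
    have "(x, i) \<noteq> (y, k - 1)" using 1(2) no_monogon' by auto
    then have "?R \<in> bigons D" using bigonI[OF x 1(1) 2] by simp
    moreover have "C = ?R \<union> join D ` ?R" using \<open>C = ?Q\<close> 1 2 y by auto
    ultimately show ?thesis by blast
  qed
qed

lemma circles_le: "3 * curves \<sigma> {} \<le> 2 * card X + card (bigons D)"
proof -
  let ?B = "{C \<in> circles D \<sigma>. card C < 6}"
  have "card ?B \<le> card ((\<lambda>R. R \<union> join D ` R) ` bigons D)"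
    using small_circle(2) finite_bigons by (intro card_mono) auto
  also have "\<dots> \<le> card (bigons D)" using finite_bigons by (rule card_image_le)
  finally have B: "card ?B \<le> card (bigons D)" .
  have "6 * card (circles D \<sigma>) = (\<Sum>C\<in>circles D \<sigma>. 6)" by simp
  also have "\<dots> \<le> (\<Sum>C\<in>circles D \<sigma>. card C + (if card C < 6 then 2 else 0))"
    using small_circle(1) by (intro sum_mono) fastforce
  also have "\<dots> = 4 * card X + 2 * card ?B"
    using finite_circles by (simp add: sum.distrib sum_card_circles sum.If_cases Int_def)
  finally show ?thesis using B by (simp add: card_circles)
qed

text \<open>
  Putting the crossings that are not long for \<open>\<rho>\<close> back into the all-\<open>\<rho>\<close> state reduces the number
  of components by at most \<open>short_classes \<rho>\<close>, and the result also arises from the mixed state \<open>\<sigma>\<close> by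
  putting back crossings of one type. Each type reduces the number of components of \<open>\<sigma>\<close> by at least
  as much as it does when the other type has been put back before, and together they leave one.
\<close>

lemma mixed_state_bound:
  defines "\<sigma> \<equiv> \<lambda>x. if x \<in> long ResA then ResA else ResB"
  shows "curves (\<lambda>_. ResA) {} + curves (\<lambda>_. ResB) {} \<le>
    curves \<sigma> {} + 1 + short_classes ResA + short_classes ResB"
proof -
  let ?A = "long ResA" and ?B = "long ResB"
  define Y :: "'a set \<Rightarrow> ('a dart \<times> 'a dart) set"
    where "Y U = {((x, i), (x, i + 2)) | x i. x \<in> U}" for U
  have B: "?B = X - ?A" using long_opposite_eq[of ResA] by simp
  have Y: "curve_rel \<sigma> U = curve_rel \<sigma> {} \<union> Y U" for U
    unfolding curve_rel_def Y_def by blast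
  have finY: "finite (Y ?A)"
  proof (rule finite_subset)
    show "Y ?A \<subseteq> S \<times> S" using long_subset[of ResA] by (auto simp: Y_def)
  qed simp
  have YX: "Y ?B \<union> Y ?A = Y X" unfolding Y_def using B long_subset[of ResA] by blast
  have all: "curve_rel \<sigma> {} \<union> Y ?B \<union> Y ?A = curve_rel \<sigma> X"
    unfolding Un_assoc YX by (rule Y[symmetric])
  have "ncomp S (curve_rel \<sigma> {} \<union> Y ?B) + ncomp S (curve_rel \<sigma> {} \<union> Y ?A) \<le>
      curves \<sigma> {} + ncomp S (curve_rel \<sigma> {} \<union> Y ?B \<union> Y ?A)"
    by (rule ncomp_supermodular[OF finite_S finY])
  then have "curves \<sigma> ?B + curves \<sigma> ?A \<le> curves \<sigma> {} + 1"
    unfolding all curves_all unfolding Y[symmetric] .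
  moreover have "curves \<sigma> ?B = curves (\<lambda>_. ResA) ?B" "curves \<sigma> ?A = curves (\<lambda>_. ResB) ?A"
    by (rule curves_cong; use B in \<open>simp add: \<sigma>_def\<close>)+
  ultimately show ?thesis
    using curves_le_reduced_edges[OF long_subset, of ResA ResB]
      curves_le_reduced_edges[OF long_subset, of ResB ResA]
    by (simp add: short_classes_def)
qed

lemma betti_sum_ge:
  assumes "tw D \<ge> 2" shows "int (tw D) + 3 \<le> 3 * (betti ResA + betti ResB)"
  using betti_eq[of ResA] betti_eq[of ResB] card_long[of ResA] mixed_state_bound
    circles_le[of "\<lambda>x. if x \<in> long ResA then ResA else ResB"] tw_add_bigons_le[OF assms]
  by simp

end

theorem theorem1p5:
  fixes D :: "'x link_diagram" and \<beta> \<beta>' :: int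
  assumes "link_diagram D"
    and "alternating_in_twist_regions D"
    and "adequate D"
    and "\<forall>R\<in>twist_regions D. card R \<ge> 3"
    and "\<beta> = jones_second_coeff D"
    and "\<beta>' = jones_next_to_last_coeff D"
  shows "(tw D \<ge> 2 \<longrightarrow> 1 / 3 * real (tw D) + 1 \<le> real_of_int (\<bar>\<beta>\<bar> + \<bar>\<beta>'\<bar>)) \<and>
         real_of_int (\<bar>\<beta>\<bar> + \<bar>\<beta>'\<bar>) \<le> 2 * real (tw D)"
proof -
  interpret twisted_diagram D
    using assms(1-4) by unfold_locales auto
  have sum: "\<bar>\<beta>\<bar> + \<bar>\<beta>'\<bar> = betti ResA + betti ResB"
    using assms(5,6) by (simp add: abs_jones_second_coeff abs_jones_next_to_last_coeff)
  have "1 / 3 * real (tw D) + 1 \<le> real_of_int (betti ResA + betti ResB)" if "tw D \<ge> 2"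
  proof -
    have "real_of_int (int (tw D) + 3) \<le> real_of_int (3 * (betti ResA + betti ResB))"
      using betti_sum_ge[OF that] by (simp only: of_int_le_iff)
    then show ?thesis by simp
  qed
  moreover have "real_of_int (betti ResA + betti ResB) \<le> real_of_int (2 * int (tw D))"
    using betti_sum_le by (simp only: of_int_le_iff)
  ultimately show ?thesis unfolding sum by simp
qed

end
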